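(* Let $(X,J)$ be an almost complex manifold with $J$ continuous, let $V\subset X$ be a closed subset that admits a locally complete pluripolar stratification, and let $u:\Delta\to X$ be a $J$-holomorphic map, where $\Delta=\{\zeta\in\mathbb{C}:|\zeta|<1\}$. Assume that for every $e^{i\theta}$ in a set $E$ of positive measure in $\partial\Delta$ the mapping $u$ has a restricted non-tangential limit $u^*(e^{i\theta})$ and that $u^*(e^{i\theta})\in V$. Then $u(\Delta)\subset V$.
   Context: An almost complex manifold $(X,J)$ is a smooth manifold $X$ with an endomorphism field $J$ of $TX$ (of the stated regularity) satisfying $J^2=-\mathrm{Id}$. A map $u:\Delta\to X$ is $J$-holomorphic if it is continuous, of class $W^{1,1}_{loc}$ in local charts, and satisfies $\frac{\partial u}{\partial x}+J(u)\frac{\partial u}{\partial y}=0$ almost everywhere ($\zeta=x+iy$). An upper semicontinuous function $\rho$ with values in $[-\infty,+\infty)$ on (an open subset of) $X$ is $J$-plurisubharmonic ($J$-psh) if $\rho\circ v$ is subharmonic for every $J$-holomorphic $v:\Delta\to X$ with values in the domain of $\rho$ (the function identically $-\infty$ being allowed as subharmonic). A subset $V$ of an almost complex manifold $(X,J)$ is locally complete pluripolar (in $X$) if for every point $p\in X$ there exist a neighborhood $U\ni p$ and a $J$-psh function $\rho$ in $U$, not identically equal to $-\infty$, such that $V\cap U=\{x\in U:\rho(x)=-\infty\}$. A closed subset $V\subset X$ admits a locally complete pluripolar stratification if it can be represented as a union $V=V_k\cup V_{k-1}\cup\dots\cup V_0$, where $V_0$ is closed and locally complete pluripolar in $(X,J)$,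 and for $j=1,\dots,k$ the set $V_j$ is a closed, locally complete pluripolar subset of the almost complex manifold $X\setminus\bigcup_{l=0}^{j-1}V_l$. For $0<\alpha<1$ and $\theta\in[0,2\pi]$ put $e^{i\theta}\Omega_\alpha=\{\zeta\in\Delta:\ |\zeta-e^{i\theta}|\zeta||<\alpha(1-|\zeta|)\}$. The map $u$ has a restricted non-tangential limit at $e^{i\theta}$, denoted $u^*(e^{i\theta})$, if for some $\alpha\in(0,1)$ (possibly depending on $\theta$) $u(\zeta)$ has the limit $u^*(e^{i\theta})\in X$ as $\zeta\to e^{i\theta}$, $\zeta\in e^{i\theta}\Omega_\alpha$. *)

theory Defs
  imports "HOL-Analysis.Analysis"
begin

section \<open>Smooth functions and weak derivatives\<close>

primrec Ck_on :: "nat \<Rightarrow> 'e::euclidean_space set \<Rightarrow> ('e \<Rightarrow> 'f::real_normed_vector) \<Rightarrow> bool" where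
  "Ck_on 0 S f \<longleftrightarrow> continuous_on S f"
| "Ck_on (Suc k) S f \<longleftrightarrow>
     (\<forall>x\<in>S. f differentiable (at x)) \<and> (\<forall>v. Ck_on k S (\<lambda>x. frechet_derivative f (at x) v))"

text \<open>Only used for open \<open>S\<close>.\<close>
definition smooth_on :: "'e::euclidean_space set \<Rightarrow> ('e \<Rightarrow> 'f::real_normed_vector) \<Rightarrow> bool" where
  "smooth_on S f \<longleftrightarrow> (\<forall>k. Ck_on k S f)"

definition test_function :: "'e::euclidean_space set \<Rightarrow> ('e \<Rightarrow> real) \<Rightarrow> bool" where
  "test_function \<Omega> \<psi> \<longleftrightarrow>
     smooth_on UNIV \<psi> \<and> (\<exists>K. compact K \<and> K \<subseteq> \<Omega> \<and> (\<forall>x. x \<notin> K \<longrightarrow> \<psi> x = 0))"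

definition locally_integrable_on ::
    "('d::euclidean_space \<Rightarrow> 'e::euclidean_space) \<Rightarrow> 'd set \<Rightarrow> bool" where
  "locally_integrable_on f \<Omega> \<longleftrightarrow> (\<forall>K. compact K \<and> K \<subseteq> \<Omega> \<longrightarrow> f absolutely_integrable_on K)"

text \<open>
  \<open>g\<close> is the distributional derivative of \<open>f\<close> on the open set \<open>\<Omega>\<close> in direction \<open>e\<close>, both being
  in \<open>L\<^sup>1\<close>-loc. A function is of class \<open>W\<^sup>1\<^sup>,\<^sup>1\<close>-loc iff it has such derivatives in all directions
  of a basis; in the complex plane \<open>e = 1\<close> and \<open>e = \<i>\<close> give the partial derivatives in \<open>x\<close> and \<open>y\<close>.
\<close>
definition has_weak_derivative_on ::
    "('d::euclidean_space \<Rightarrow> 'e::euclidean_space) \<Rightarrow> 'd \<Rightarrow> ('d \<Rightarrow> 'e) \<Rightarrow> 'd set \<Rightarrow> bool" where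
  "has_weak_derivative_on f e g \<Omega> \<longleftrightarrow>
     locally_integrable_on f \<Omega> \<and> locally_integrable_on g \<Omega> \<and>
     (\<forall>\<psi>. test_function \<Omega> \<psi> \<longrightarrow>
        integral \<Omega> (\<lambda>z. frechet_derivative \<psi> (at z) e *\<^sub>R f z) = - integral \<Omega> (\<lambda>z. \<psi> z *\<^sub>R g z))"


section \<open>Almost complex manifolds\<close>

text \<open>
  A chart is a pair of an open domain and a coordinate map; the values of the map outside the
  domain are irrelevant. The manifold \<open>X\<close> is an open subset of its (Hausdorff, second countable)
  ambient type, possibly all of it.
\<close>
type_synonym ('a, 'e) chart = "'a set \<times> ('a \<Rightarrow> 'e)"

definition is_chart :: "('a::topological_space, 'e::euclidean_space) chart \<Rightarrow> bool" where
  "is_chart c \<longleftrightarrow> (case c of (D, \<phi>) \<Rightarrow>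
     open D \<and> open (\<phi> ` D) \<and> homeomorphism D (\<phi> ` D) \<phi> (inv_into D \<phi>))"

text \<open>The coordinate change from \<open>c\<close> to \<open>c'\<close>, to be used on \<open>snd c ` (fst c \<inter> fst c')\<close>.\<close>
definition transition :: "('a, 'e) chart \<Rightarrow> ('a, 'e) chart \<Rightarrow> 'e \<Rightarrow> 'e" where
  "transition c c' = snd c' \<circ> inv_into (fst c) (snd c)"

definition smooth_manifold ::
    "'a::{t2_space, second_countable_topology} set \<Rightarrow> ('a, 'e::euclidean_space) chart set \<Rightarrow> bool" where
  "smooth_manifold X A \<longleftrightarrow>
     X = (\<Union>c\<in>A. fst c) \<and> (\<forall>c\<in>A. is_chart c) \<and>
     (\<forall>c\<in>A. \<forall>c'\<in>A. smooth_on (snd c ` (fst c \<inter> fst c')) (transition c c'))"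

text \<open>
  An endomorphism field of the tangent bundle is given by its local representatives: \<open>J c p\<close> is the
  endomorphism of the tangent space at \<open>p\<close> expressed in the chart \<open>c\<close> (for \<open>c\<close> in the atlas and \<open>p\<close>
  in its domain), and the representatives in different charts are intertwined by the differential
  of the coordinate change.
\<close>
type_synonym ('a, 'e) endo_field = "('a, 'e) chart \<Rightarrow> 'a \<Rightarrow> 'e \<Rightarrow>\<^sub>L 'e"

definition endomorphism_field ::
    "('a::topological_space, 'e::euclidean_space) chart set \<Rightarrow> ('a, 'e) endo_field \<Rightarrow> bool" where
  "endomorphism_field A J \<longleftrightarrow>
     (\<forall>c\<in>A. \<forall>c'\<in>A. \<forall>p \<in> fst c \<inter> fst c'. \<forall>v.
        blinfun_apply (J c' p) (frechet_derivative (transition c c') (at (snd c p)) v) =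
        frechet_derivative (transition c c') (at (snd c p)) (blinfun_apply (J c p) v))"

definition continuous_field ::
    "('a::topological_space, 'e::euclidean_space) chart set \<Rightarrow> ('a, 'e) endo_field \<Rightarrow> bool" where
  "continuous_field A J \<longleftrightarrow> (\<forall>c\<in>A. continuous_on (fst c) (J c))"

definition almost_complex_manifold ::
    "'a::{t2_space, second_countable_topology} set \<Rightarrow> ('a, 'e::euclidean_space) chart set \<Rightarrow>
     ('a, 'e) endo_field \<Rightarrow> bool" where
  "almost_complex_manifold X A J \<longleftrightarrow>
     smooth_manifold X A \<and> endomorphism_field A J \<and>
     (\<forall>c\<in>A. \<forall>p\<in>fst c. J c p o\<^sub>L J c p = - id_blinfun)"

abbreviation unit_disc :: "complex set" (\<open>\<Delta>\<close>) where
  "\<Delta> \<equiv> ball 0 1"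

text \<open>
  The functions \<open>fx\<close> and \<open>fy\<close> below are the weak partial derivatives of the coordinate expression
  of \<open>u\<close>, which are unique up to null sets.
\<close>
definition J_holomorphic ::
    "'a::{t2_space, second_countable_topology} set \<Rightarrow> ('a, 'e::euclidean_space) chart set \<Rightarrow>
     ('a, 'e) endo_field \<Rightarrow> (complex \<Rightarrow> 'a) \<Rightarrow> bool" where
  "J_holomorphic X A J u \<longleftrightarrow>
     u ` \<Delta> \<subseteq> X \<and> continuous_on \<Delta> u \<and>
     (\<forall>c\<in>A. let \<Omega> = {z \<in> \<Delta>. u z \<in> fst c} in
        \<exists>fx fy. has_weak_derivative_on (snd c \<circ> u) 1 fx \<Omega> \<and>
                has_weak_derivative_on (snd c \<circ> u) \<i> fy \<Omega> \<and>
                (AE z in lebesgue. z \<in> \<Omega> \<longrightarrow> fx z + blinfun_apply (J c (u z)) (fy z) = 0))"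


section \<open>Subharmonic and plurisubharmonic functions\<close>

definition usc_on :: "'a::topological_space set \<Rightarrow> ('a \<Rightarrow> ereal) \<Rightarrow> bool" where
  "usc_on S f \<longleftrightarrow> (\<forall>x\<in>S. \<forall>y. f x < y \<longrightarrow> (\<forall>\<^sub>F z in at x within S. f z < y))"

text \<open>
  Lebesgue integral of an extended real function as the difference of the integrals of its
  positive and negative parts (\<open>e2ennreal\<close> sends negative values to \<open>0\<close>). It is meaningful when the
  first of them is finite, in particular for functions bounded above on a finite measure space.
\<close>
definition ext_integral :: "'b measure \<Rightarrow> ('b \<Rightarrow> ereal) \<Rightarrow> ereal" where
  "ext_integral M f =
     enn2ereal (\<integral>\<^sup>+ x. e2ennreal (f x) \<partial>M) - enn2ereal (\<integral>\<^sup>+ x. e2ennreal (- f x) \<partial>M)"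

definition circle_mean :: "(complex \<Rightarrow> ereal) \<Rightarrow> complex \<Rightarrow> real \<Rightarrow> ereal" where
  "circle_mean f a r =
     ext_integral (uniform_measure lborel {0..2*pi}) (\<lambda>t. f (a + of_real r * cis t))"

text \<open>The constant function \<open>-\<infinity>\<close> counts as subharmonic.\<close>
definition subharmonic_on :: "complex set \<Rightarrow> (complex \<Rightarrow> ereal) \<Rightarrow> bool" where
  "subharmonic_on \<Omega> f \<longleftrightarrow>
     usc_on \<Omega> f \<and> (\<forall>z\<in>\<Omega>. f z < \<infinity>) \<and>
     (\<forall>a r. 0 < r \<and> cball a r \<subseteq> \<Omega> \<longrightarrow> f a \<le> circle_mean f a r)"

definition J_psh_on ::
    "'a::{t2_space, second_countable_topology} set \<Rightarrow> ('a, 'e::euclidean_space) chart set \<Rightarrow>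
     ('a, 'e) endo_field \<Rightarrow> 'a set \<Rightarrow> ('a \<Rightarrow> ereal) \<Rightarrow> bool" where
  "J_psh_on X A J U \<rho> \<longleftrightarrow>
     usc_on U \<rho> \<and> (\<forall>x\<in>U. \<rho> x < \<infinity>) \<and>
     (\<forall>v. J_holomorphic X A J v \<and> v ` \<Delta> \<subseteq> U \<longrightarrow> subharmonic_on \<Delta> (\<rho> \<circ> v))"


section \<open>Locally complete pluripolar stratifications\<close>

text \<open>
  \<open>M\<close> is an open subset of \<open>X\<close>, regarded as an almost complex manifold with the structure induced
  from \<open>X\<close>. Since the neighbourhoods \<open>U\<close> lie in \<open>M\<close>, plurisubharmonicity on \<open>U\<close> is the same with
  respect to \<open>M\<close> and to \<open>X\<close>.
\<close>
definition locally_complete_pluripolar ::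
    "'a::{t2_space, second_countable_topology} set \<Rightarrow> ('a, 'e::euclidean_space) chart set \<Rightarrow>
     ('a, 'e) endo_field \<Rightarrow> 'a set \<Rightarrow> 'a set \<Rightarrow> bool" where
  "locally_complete_pluripolar X A J M V \<longleftrightarrow>
     V \<subseteq> M \<and>
     (\<forall>p\<in>M. \<exists>U \<rho>. open U \<and> p \<in> U \<and> U \<subseteq> M \<and> J_psh_on X A J U \<rho> \<and>
        (\<exists>x\<in>U. \<rho> x \<noteq> -\<infinity>) \<and> V \<inter> U = {x \<in> U. \<rho> x = -\<infinity>})"

text \<open>For \<open>j = 0\<close> the manifold \<open>X - (\<Union>l<j. Vs l)\<close> is \<open>X\<close> itself.\<close>
definition has_lcp_stratification ::
    "'a::{t2_space, second_countable_topology} set \<Rightarrow> ('a, 'e::euclidean_space) chart set \<Rightarrow>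
     ('a, 'e) endo_field \<Rightarrow> 'a set \<Rightarrow> bool" where
  "has_lcp_stratification X A J V \<longleftrightarrow>
     (\<exists>(k::nat) Vs. V = (\<Union>j\<le>k. Vs j) \<and>
        (\<forall>j\<le>k. let M = X - (\<Union>l<j. Vs l) in
           closedin (top_of_set M) (Vs j) \<and> locally_complete_pluripolar X A J M (Vs j)))"


section \<open>Restricted non-tangential limits\<close>

definition approach_region :: "real \<Rightarrow> complex \<Rightarrow> complex set" where
  "approach_region \<alpha> \<omega> = {z \<in> \<Delta>. cmod (z - \<omega> * of_real (cmod z)) < \<alpha> * (1 - cmod z)}"

text \<open>
  \<open>p\<close> is a restricted non-tangential limit of \<open>u\<close> at \<open>\<omega>\<close> with \<open>|\<omega>| = 1\<close>. It is unique, as every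
  approach region contains the radius towards \<open>\<omega>\<close>.
\<close>
definition has_restricted_nt_limit ::
    "(complex \<Rightarrow> 'a::topological_space) \<Rightarrow> complex \<Rightarrow> 'a \<Rightarrow> bool" where
  "has_restricted_nt_limit u \<omega> p \<longleftrightarrow>
     (\<exists>\<alpha>. 0 < \<alpha> \<and> \<alpha> < 1 \<and> (u \<longlongrightarrow> p) (at \<omega> within approach_region \<alpha> \<omega>))"

text \<open>Angles of the points of a subset of the unit circle; arc length is Lebesgue measure of angles.\<close>
definition angles :: "complex set \<Rightarrow> real set" where
  "angles E = {\<theta> \<in> {0..2*pi}. cis \<theta> \<in> E}"

end

theory Submission
  imports Defs "HOL-Complex_Analysis.Cauchy_Integral_Formula" "HOL-Real_Asymp.Real_Asymp"
begin

text \<open>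
  Some stratum \<open>V\<^sub>j\<close> carries the boundary values on a set of positive measure, and there \<open>V\<^sub>j\<close> is the
  \<open>-\<infinity>\<close>-set of a psh function \<open>\<rho>\<close>. By Egorov's argument there is a compact set \<open>K\<close> of angles of
  positive measure such that \<open>\<rho> \<circ> u\<close> is defined and bounded above on a sawtooth region over \<open>K\<close> and
  tends to \<open>-\<infinity>\<close> uniformly at the unit circle. As in Privalov's uniqueness theorem, the maximum principle on
  this region makes \<open>\<rho> \<circ> u\<close> equal to \<open>-\<infinity>\<close> on an open set, which \<open>u\<close> therefore maps into \<open>V\<^sub>j\<close>.
  On the other hand, a closed polar set has empty interior and does not disconnect; by induction on
  the strata, the preimage of \<open>V\<^sub>0 \<union> \<dots> \<union> V\<^sub>j\<close> is the whole disc or has empty interior.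
\<close>

section \<open>Sub-mean value property and maximum principle\<close>

text \<open>Plurisubharmonicity is tested only along holomorphic maps of the whole unit disc into
  the domain of \<rho>, and \<open>u\<close> leaves that domain. Small discs are therefore rescaled
  to \<Delta>; this is where the equation for \<open>u\<close> enters, and it gives a mean value
  inequality on small circles only. What follows is potential theory in the plane, based on a
  maximum principle for this local inequality.

  The classical uniqueness proof maps the sawtooth region conformally to a disc and needs a
  rectifiable boundary. Here an explicit superharmonic function with a free factor N replaces the
  conformal map: its bracket is nonnegative on the boundary inside the disc and at least -1 near the
  unit circle, where the uniform limit -\<infinity> absorbs the loss N.

  The other obstacle is measurability: the limit, the aperture and the local function \<rho> all
  vary with the angle without any control. So the angles are sorted into countably many classes
  (stratum, basic open set, aperture), one \<rho> is fixed per class, and each class is covered by a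
  set built from closed sets of angles.\<close>

lemma usc_on_subset:
  assumes "usc_on S f" "T \<subseteq> S"
  shows "usc_on T f"
  unfolding usc_on_def
proof (intro ballI allI impI)
  fix x y assume "x \<in> T" "f x < y"
  then have "\<forall>\<^sub>F z in at x within S. f z < y"
    using assms by (auto simp: usc_on_def)
  with at_le[OF assms(2)] show "\<forall>\<^sub>F z in at x within T. f z < y"
    by (rule filter_leD)
qed

lemma usc_onD:
  assumes "usc_on S f" "x \<in> S" "f x < y"
  shows "\<exists>T. open T \<and> x \<in> T \<and> (\<forall>z\<in>T \<inter> S. f z < y)"
proof -
  have "\<forall>\<^sub>F z in at x within S. f z < y"
    using assms unfolding usc_on_def by blast
  then obtain T where "open T" "x \<in> T" "\<forall>z\<in>T. z \<noteq> x \<longrightarrow> z \<in> S \<longrightarrow> f z < y"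
    unfolding eventually_at_topological by blast
  then show ?thesis
    using assms(3) by (intro exI[of _ T]) (metis Int_iff)
qed

lemma usc_on_diff:
  assumes h: "usc_on S h" and g: "continuous_on S g"
  shows "usc_on S (\<lambda>z. h z - ereal (g z))"
  unfolding usc_on_def
proof (intro ballI allI impI)
  fix x y assume x: "x \<in> S" and "h x - ereal (g x) < y"
  then have "h x < y + ereal (g x)"
    by (simp add: ereal_minus_less)
  then obtain s where s: "h x < ereal s" "ereal s < y + ereal (g x)"
    using ereal_dense2 by blast
  \<comment> \<open>The gap between \<open>s\<close> and \<open>s'\<close> is what the variation of
    \<open>g\<close> near \<open>x\<close> may use up.\<close>
  then obtain s' where s': "ereal s < ereal s'" "ereal s' < y + ereal (g x)"
    using ereal_dense2 by blast
  have 1: "\<forall>\<^sub>F z in at x within S. h z < ereal s"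
    using h x s unfolding usc_on_def by blast
  have "(g \<longlongrightarrow> g x) (at x within S)"
    using g x continuous_on_def by blast
  then have 2: "\<forall>\<^sub>F z in at x within S. g z > g x - (s' - s)"
    using s'(1) by (intro order_tendstoD) auto
  show "\<forall>\<^sub>F z in at x within S. h z - ereal (g z) < y"
    using 1 2
  proof eventually_elim
    case (elim z)
    have "ereal s < y + ereal (g z)"
      using s' elim(2) by (cases y) auto
    then have "h z < y + ereal (g z)"
      using elim(1) by order
    then show ?case
      by (simp add: ereal_minus_less)
  qed
qed

text \<open>If no point were maximal, every \<open>x\<close> would have a strictly better point
  \<open>y x\<close>, which by semicontinuity beats a whole neighbourhood of \<open>x\<close>.
  Finitely many neighbourhoods cover \<open>C\<close>, but the best of the finitely many points
  \<open>y x\<close> lies in one of them and is beaten.\<close>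

lemma usc_attains_sup:
  assumes "compact C" "C \<noteq> {}" "usc_on C f"
  shows "\<exists>a\<in>C. \<forall>z\<in>C. f z \<le> f a"
proof (rule ccontr)
  assume "\<not> ?thesis"
  then have "\<exists>y\<in>C. f x < f y" if "x \<in> C" for x
    using that by (meson linorder_not_le)
  then obtain y where y: "\<And>x. x \<in> C \<Longrightarrow> y x \<in> C \<and> f x < f (y x)"
    by metis
  have "\<exists>T. open T \<and> x \<in> T \<and> (\<forall>z\<in>T \<inter> C. f z < f (y x))" if "x \<in> C" for x
    using usc_onD[OF assms(3) that] y[OF that] by blast
  then obtain T where T: "\<And>x. x \<in> C \<Longrightarrow> open (T x) \<and> x \<in> T x \<and> (\<forall>z\<in>T x \<inter> C. f z < f (y x))"
    by metis
  then have "\<And>x. x \<in> C \<Longrightarrow> open (T x)" "C \<subseteq> (\<Union>x\<in>C. T x)" by auto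
  then obtain D where D: "D \<subseteq> C" "finite D" "C \<subseteq> (\<Union>x\<in>D. T x)"
    using compactE_image[OF assms(1), of C T] by blast
  then have "D \<noteq> {}" using assms(2) by auto
  define m where "m = Max ((\<lambda>x. f (y x)) ` D)"
  have "m \<in> (\<lambda>x. f (y x)) ` D"
    unfolding m_def using D \<open>D \<noteq> {}\<close> by (intro Max_in) auto
  then obtain x0 where x0: "x0 \<in> D" "m = f (y x0)" by auto
  then have "y x0 \<in> C" using D y by blast
  then obtain x1 where x1: "x1 \<in> D" "y x0 \<in> T x1" using D by blast
  then have "f (y x0) < f (y x1)"
    using T D \<open>y x0 \<in> C\<close> by blast
  moreover have "f (y x1) \<le> m"
    unfolding m_def using D x1 by (intro Max_ge) auto
  ultimately show False using x0 by order
qed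

section \<open>Means of continuous functions over circles\<close>

definition cmean :: "(complex \<Rightarrow> real) \<Rightarrow> complex \<Rightarrow> real \<Rightarrow> real" where
  "cmean w a r = integral {0..2*pi} (\<lambda>t. w (a + of_real r * cis t)) / (2*pi)"

lemma circle_in_sphere [simp]: "r \<ge> 0 \<Longrightarrow> a + of_real r * cis t \<in> sphere a r"
  by (simp add: dist_norm norm_mult)

lemma continuous_on_circle:
  assumes "continuous_on (sphere a r) w" "r \<ge> 0"
  shows "continuous_on S (\<lambda>t. w (a + of_real r * cis t))"
  by (rule continuous_on_compose2[OF assms(1)]) (use assms(2) in \<open>auto intro!: continuous_intros simp: dist_norm norm_mult\<close>)

lemma integrable_on_circle:
  fixes w :: "complex \<Rightarrow> real"
  assumes "continuous_on (sphere a r) w" "r \<ge> 0"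
  shows "(\<lambda>t. w (a + of_real r * cis t)) integrable_on {0..2*pi}"
  by (intro integrable_continuous_real continuous_on_circle assms)

lemma cmean_add:
  assumes "continuous_on (sphere a r) v" "continuous_on (sphere a r) w" "r \<ge> 0"
  shows "cmean (\<lambda>z. v z + w z) a r = cmean v a r + cmean w a r"
  using assms by (simp add: cmean_def Henstock_Kurzweil_Integration.integral_add
      integrable_on_circle add_divide_distrib)

lemma cmean_cmult: "cmean (\<lambda>z. c * w z) a r = c * cmean w a r"
  by (simp add: cmean_def)

lemma cmean_const [simp]: "cmean (\<lambda>z. c) a r = c"
  by (simp add: cmean_def)

lemma cmean_cong:
  assumes "r \<ge> 0" "\<And>z. z \<in> sphere a r \<Longrightarrow> v z = w z"
  shows "cmean v a r = cmean w a r"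
  unfolding cmean_def using assms(2)[OF circle_in_sphere[OF assms(1)]] by simp

text \<open>Cauchy's formula, with dz / (z - a) equal to i dt on the circle. All mean values
  computed below (logarithm, Poisson kernel, |z|^2) come from writing the function on the circle as
  such a real part.\<close>

lemma cmean_Re_holomorphic:
  assumes "F holomorphic_on cball a r" "r > 0"
  shows "cmean (\<lambda>z. Re (F z)) a r = Re (F a)"
proof -
  have "((\<lambda>u. F u / (u - a)) has_contour_integral (2 * of_real pi * \<i> * F a)) (circlepath a r)"
    using assms by (intro Cauchy_integral_circlepath_simple) auto
  then have "((\<lambda>t. F (a + r * cis t) / (r * cis t) * r * \<i> * cis t)
      has_integral (2 * of_real pi * \<i> * F a)) {0..2*pi}"
    unfolding circlepath_def by (subst (asm) has_contour_integral_part_circlepath_iff) auto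
  also have "(\<lambda>t. F (a + r * cis t) / (r * cis t) * r * \<i> * cis t) =
      (\<lambda>t. \<i> * F (a + r * cis t))"
    using assms(2) by (auto simp: fun_eq_iff)
  finally have "((\<lambda>t. - \<i> * (\<i> * F (a + r * cis t))) has_integral
      (- \<i> * (2 * of_real pi * \<i> * F a))) {0..2*pi}"
    by (rule has_integral_mult_right)
  moreover have "- \<i> * (\<i> * z) = z" "- \<i> * (2 * of_real pi * \<i> * z) = 2 * of_real pi * z" for z
    by (simp_all add: complex_eq_iff)
  ultimately have "((\<lambda>t. F (a + r * cis t)) has_integral (2 * of_real pi * F a)) {0..2*pi}"
    by (simp only:)
  then have "((\<lambda>t. Re (F (a + r * cis t))) has_integral (Re (2 * of_real pi * F a))) {0..2*pi}"
    by (rule has_integral_Re)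
  then show ?thesis
    unfolding cmean_def by (simp add: integral_unique)
qed

text \<open>On the circle |z - a| = r the function |z|^2 agrees with the real part of an affine
  function of \<open>z\<close>. The surplus r^2 over the value at the centre gives the strict
  inequality in the maximum principle.\<close>

lemma cmean_norm_square:
  assumes "r > 0"
  shows "cmean (\<lambda>z. (cmod z)\<^sup>2) a r = (cmod a)\<^sup>2 + r\<^sup>2"
proof -
  define F where "F z = complex_of_real ((cmod a)\<^sup>2 + r\<^sup>2) + 2 * cnj a * (z - a)" for z
  have "(cmod z)\<^sup>2 = Re (F z)" if "z \<in> sphere a r" for z
  proof -
    have "cmod (z - a) = r" using that by (simp add: dist_norm norm_minus_commute)
    then have "(cmod (z - a))\<^sup>2 = r\<^sup>2" by simp
    then show ?thesis
      unfolding F_def cmod_power2 by (simp add: cmod_power2) (simp add: algebra_simps power2_eq_square)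
  qed
  then have "cmean (\<lambda>z. (cmod z)\<^sup>2) a r = cmean (\<lambda>z. Re (F z)) a r"
    using assms by (intro cmean_cong) auto
  also have "\<dots> = Re (F a)"
    unfolding F_def using assms by (intro cmean_Re_holomorphic holomorphic_intros)
  finally show ?thesis by (simp add: F_def)
qed

text \<open>
  The circle mean of \<open>h\<close> is tested through continuous majorants, and only on small circles: this is
  inherited by functions that are patched together from subharmonic ones.
\<close>
definition locally_submean :: "complex set \<Rightarrow> (complex \<Rightarrow> ereal) \<Rightarrow> bool" where
  "locally_submean W h \<longleftrightarrow> usc_on W h \<and> (\<forall>z\<in>W. h z < \<infinity>) \<and>
     (\<forall>a\<in>W. \<exists>r0>0. \<forall>r g. 0 < r \<and> r < r0 \<and> continuous_on (sphere a r) g \<and>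
        (\<forall>z\<in>sphere a r. h z \<le> ereal (g z)) \<longrightarrow> h a \<le> ereal (cmean g a r))"

definition locally_supermean :: "complex set \<Rightarrow> (complex \<Rightarrow> real) \<Rightarrow> bool" where
  "locally_supermean D w \<longleftrightarrow> continuous_on D w \<and>
     (\<forall>a\<in>D. \<exists>r0>0. \<forall>r. 0 < r \<and> r < r0 \<longrightarrow> cmean w a r \<le> w a)"

lemma locally_submean_subset:
  assumes "locally_submean W h" "D \<subseteq> W"
  shows "locally_submean D h"
  using assms usc_on_subset unfolding locally_submean_def by (meson subsetD)

text \<open>The boundary hypothesis says that limsup (h - w) is at most 0 at every frontier point,
  in a form that uses no values outside \<open>D\<close>. If h - w were positive somewhere, a slight
  perturbation of it would attain a maximum inside \<open>D\<close>, against the strict mean value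
  inequality.\<close>

lemma max_principle:
  assumes "open D" "bounded D" and h: "locally_submean D h" and w: "locally_supermean D w"
    and bdry: "\<And>z \<epsilon>. z \<in> frontier D \<Longrightarrow> \<epsilon> > 0 \<Longrightarrow>
      \<exists>T. open T \<and> z \<in> T \<and> (\<forall>x\<in>T \<inter> D. h x \<le> ereal (w x + \<epsilon>))"
    and "z \<in> D"
  shows "h z \<le> ereal (w z)"
proof (rule ccontr)
  assume "\<not> ?thesis"
  then have less: "ereal (w z) < h z" by simp
  have "h z < \<infinity>" using h \<open>z \<in> D\<close> by (auto simp: locally_submean_def)
  with less obtain hz where hz: "h z = ereal hz" by (cases "h z") auto
  \<comment> \<open>Half the gap at \<open>z\<close>. The perturbation is at most \<eta> on
    \<open>D\<close>, so off the level set \<open>C\<close> the perturbed difference stays below 2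
    \<eta>, hence below its value at \<open>z\<close>; a maximum over the compact set
    \<open>C\<close> is then a maximum over \<open>D\<close>.\<close>
  define \<eta> where "\<eta> = (hz - w z) / 2"
  have "\<eta> > 0" using less hz by (simp add: \<eta>_def)
  obtain R where R: "R > 0" "\<And>x. x \<in> D \<Longrightarrow> cmod x \<le> R"
    using \<open>bounded D\<close> bounded_pos by blast
  \<comment> \<open>Adding a small multiple of \<open>|x|\<^sup>2\<close> makes the mean value inequality for \<open>h - w\<close> strict.\<close>
  define \<epsilon> where "\<epsilon> = \<eta> / R\<^sup>2"
  have "\<epsilon> > 0" using \<open>\<eta> > 0\<close> R by (simp add: \<epsilon>_def)
  have eR: "\<epsilon> * (cmod x)\<^sup>2 \<le> \<eta>" if "x \<in> D" for x
  proof -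
    have "\<epsilon> * (cmod x)\<^sup>2 \<le> \<epsilon> * R\<^sup>2"
      using R that \<open>\<epsilon> > 0\<close> by (intro mult_left_mono power_mono) auto
    then show ?thesis using R by (simp add: \<epsilon>_def)
  qed
  have contw: "continuous_on D w" using w by (simp add: locally_supermean_def)
  have usch: "usc_on D h" using h by (simp add: locally_submean_def)
  define C where "C = {x \<in> D. ereal \<eta> \<le> h x - ereal (w x)}"
  have uscd: "usc_on D (\<lambda>x. h x - ereal (w x))" by (rule usc_on_diff[OF usch contw])
  have "z \<in> C" using \<open>z \<in> D\<close> hz \<open>\<eta> > 0\<close> by (simp add: C_def \<eta>_def field_simps)
  have "closed C"
    unfolding closed_def
  proof (rule openI)
    fix x assume x: "x \<in> - C"
    show "\<exists>e>0. ball x e \<subseteq> - C"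
    proof -
      consider "x \<in> D" | "x \<in> frontier D" | "x \<in> - closure D"
        by (metis Diff_iff frontier_def Compl_iff interior_open[OF \<open>open D\<close>])
      then obtain T where "open T" "x \<in> T" "T \<subseteq> - C"
      proof cases
        case 1
        then have "h x - ereal (w x) < ereal \<eta>" using x by (auto simp: C_def)
        then obtain T where T: "open T" "x \<in> T" "\<forall>z\<in>T \<inter> D. h z - ereal (w z) < ereal \<eta>"
          using usc_onD[OF uscd 1] by blast
        moreover have "T \<subseteq> - C"
        proof (intro subsetI ComplI)
          fix y assume "y \<in> T" "y \<in> C"
          then have "h y - ereal (w y) < ereal \<eta>" "ereal \<eta> \<le> h y - ereal (w y)"
            using T by (auto simp: C_def)
          then show False by order
        qed
        ultimately show ?thesis using that by blast
      next
        case 2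
        then obtain T where T: "open T" "x \<in> T" "\<forall>x\<in>T \<inter> D. h x \<le> ereal (w x + \<eta>/2)"
          using bdry[of x "\<eta>/2"] \<open>\<eta> > 0\<close> by auto
        have "T \<subseteq> - C"
        proof
          fix y assume y: "y \<in> T"
          show "y \<in> - C"
          proof
            assume "y \<in> C"
            then have "h y \<le> ereal (w y + \<eta>/2)" "ereal \<eta> \<le> h y - ereal (w y)"
              using T y by (auto simp: C_def)
            then show False using \<open>\<eta> > 0\<close> by (cases "h y") auto
          qed
        qed
        then show ?thesis using T that by blast
      next
        case 3
        have "- closure D \<subseteq> - C" using closure_subset C_def by fastforce
        then show ?thesis using 3 that[of "- closure D"] by auto
      qed
      then show ?thesis by (meson open_contains_ball subset_trans)
    qed
  qed
  moreover have "bounded C" using \<open>bounded D\<close> by (rule bounded_subset) (auto simp: C_def)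
  ultimately have "compact C" using compact_eq_bounded_closed by blast
  define g where "g x = w x - \<epsilon> * (cmod x)\<^sup>2" for x
  have contg: "continuous_on D g" unfolding g_def by (intro continuous_intros contw)
  have "usc_on C (\<lambda>x. h x - ereal (g x))"
    by (rule usc_on_subset[OF usc_on_diff[OF usch contg]]) (auto simp: C_def)
  then obtain a where a: "a \<in> C" "\<And>x. x \<in> C \<Longrightarrow> h x - ereal (g x) \<le> h a - ereal (g a)"
    using usc_attains_sup[OF \<open>compact C\<close>] \<open>z \<in> C\<close> by blast
  have aD: "a \<in> D" using a by (simp add: C_def)
  have "h a < \<infinity>" using h aD by (auto simp: locally_submean_def)
  moreover have "ereal \<eta> \<le> h a - ereal (w a)" using a by (simp add: C_def)
  ultimately obtain ha where ha: "h a = ereal ha" by (cases "h a") auto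
  define s where "s = ha - g a"
  have s: "s \<ge> 2 * \<eta>"
  proof -
    have "ereal (hz - g z) \<le> ereal s"
      using a(2)[OF \<open>z \<in> C\<close>] ha hz by (simp add: s_def)
    moreover have "hz - g z \<ge> 2 * \<eta>" using \<open>\<epsilon> > 0\<close> by (simp add: g_def \<eta>_def)
    ultimately show ?thesis by simp
  qed
  have le: "h x \<le> ereal (g x + s)" if "x \<in> D" for x
  proof (cases "x \<in> C")
    case True
    then have "h x - ereal (g x) \<le> ereal s" using a(2)[of x] ha by (simp add: s_def)
    then show ?thesis by (cases "h x") auto
  next
    case False
    then have "h x - ereal (w x) < ereal \<eta>" using that by (auto simp: C_def)
    then have "h x \<le> ereal (w x + \<eta>)" by (cases "h x") auto
    also have "w x + \<eta> \<le> g x + s" using eR[OF that] s by (simp add: g_def)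
    finally show ?thesis by simp
  qed
  obtain r1 where r1: "r1 > 0" "\<And>r g. \<lbrakk>0 < r; r < r1; continuous_on (sphere a r) g;
       \<forall>z\<in>sphere a r. h z \<le> ereal (g z)\<rbrakk> \<Longrightarrow> h a \<le> ereal (cmean g a r)"
    using h aD unfolding locally_submean_def by metis
  obtain r2 where r2: "r2 > 0" "\<And>r. \<lbrakk>0 < r; r < r2\<rbrakk> \<Longrightarrow> cmean w a r \<le> w a"
    using w aD unfolding locally_supermean_def by metis
  obtain r3 where r3: "r3 > 0" "cball a r3 \<subseteq> D"
    using \<open>open D\<close> aD open_contains_cball by blast
  define r where "r = min r3 (min (r1/2) (r2/2))"
  have r: "0 < r" "r < r1" "r < r2" "sphere a r \<subseteq> D"
    using r1(1) r2(1) r3 by (auto simp: r_def subset_iff)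
  have csph: "continuous_on (sphere a r) w"
    using contw r(4) continuous_on_subset by blast
  have "h a \<le> ereal (cmean (\<lambda>x. g x + s) a r)"
  proof (rule r1(2)[OF r(1,2)])
    show "continuous_on (sphere a r) (\<lambda>x. g x + s)"
      by (intro continuous_intros continuous_on_subset[OF contg] r)
    show "\<forall>z\<in>sphere a r. h z \<le> ereal (g z + s)" using le r(4) by blast
  qed
  also have "cmean (\<lambda>x. g x + s) a r = cmean (\<lambda>x. w x + ((- \<epsilon>) * (cmod x)\<^sup>2 + s)) a r"
    by (simp add: g_def algebra_simps)
  also have "\<dots> = cmean w a r + ((- \<epsilon>) * ((cmod a)\<^sup>2 + r\<^sup>2) + s)"
  proof -
    have "cmean (\<lambda>x. (- \<epsilon>) * (cmod x)\<^sup>2 + s) a r = (- \<epsilon>) * ((cmod a)\<^sup>2 + r\<^sup>2) + s"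
      using r by (subst cmean_add; (subst cmean_cmult)?)
        (auto intro!: continuous_intros simp: cmean_norm_square)
    then show ?thesis
      using r csph by (subst cmean_add) (auto intro!: continuous_intros)
  qed
  finally have "ha \<le> cmean w a r - \<epsilon> * ((cmod a)\<^sup>2 + r\<^sup>2) + s"
    using ha by simp
  also have "\<dots> \<le> w a - \<epsilon> * ((cmod a)\<^sup>2 + r\<^sup>2) + s"
    using r2(2)[OF r(1,3)] by simp
  also have "\<dots> = ha - \<epsilon> * r\<^sup>2"
    by (simp add: s_def g_def algebra_simps)
  finally show False using \<open>\<epsilon> > 0\<close> r(1) by (simp add: mult_le_0_iff)
qed


section \<open>Identity principle\<close>

lemma locally_supermean_ln:
  assumes "b \<notin> S"
  shows "locally_supermean S (\<lambda>z. M + C * ln (cmod (z - b) / R))"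
proof (cases "R = 0")
  \<comment> \<open>With \<open>R = 0\<close> the quotient is 0 everywhere, so the function is
    constant.\<close>
  case True
  then show ?thesis by (auto simp: locally_supermean_def intro: exI[of _ 1])
next
  case False
  define w where "w z = M + C * ln (cmod (z - b) / R)" for z
  have *: "cmean w a r \<le> w a" if "a \<noteq> b" "0 < r" "r < cmod (a - b)" for a r
  proof -
    \<comment> \<open>On a disc around \<open>a\<close> that avoids \<open>b\<close>, the quotient
      (z - b) / (a - b) stays within distance 1 of 1, hence in the right half plane. The principal
      branch suffices there, although no logarithm of z - b exists around \<open>b\<close>.\<close>
    define F where "F z = complex_of_real (w a) + C * Ln ((z - b) / (a - b))" for z
    have mem: "(z - b) / (a - b) \<notin> \<real>\<^sub>\<le>\<^sub>0" if "z \<in> cball a r" for z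
    proof -
      have "(z - b) / (a - b) - 1 = (z - a) / (a - b)"
        using \<open>a \<noteq> b\<close> by (simp add: field_simps)
      then have "cmod ((z - b) / (a - b) - 1) = cmod (z - a) / cmod (a - b)"
        by (simp add: norm_divide)
      also have "\<dots> < 1"
      proof -
        have "cmod (z - a) < cmod (a - b)"
          using that \<open>r < cmod (a - b)\<close> by (simp add: dist_norm norm_minus_commute)
        then show ?thesis using \<open>a \<noteq> b\<close> by simp
      qed
      finally have "\<bar>Re ((z - b) / (a - b) - 1)\<bar> < 1"
        using abs_Re_le_cmod order_le_less_trans by blast
      then have "Re ((z - b) / (a - b)) > 0" by simp
      then show ?thesis by (auto simp: complex_nonpos_Reals_iff)
    qed
    have "w z = Re (F z)" if "z \<in> sphere a r" for z
    proof -
      have "z \<in> cball a r" using that by auto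
      then have "z \<noteq> b" using mem[of z] by auto
      then have "Re (Ln ((z - b) / (a - b))) = ln (cmod (z - b) / cmod (a - b))"
        using \<open>a \<noteq> b\<close> by (simp add: norm_divide)
      also have "\<dots> = ln (cmod (z - b) / R) - ln (cmod (a - b) / R)"
        using \<open>z \<noteq> b\<close> \<open>a \<noteq> b\<close> False by (simp add: ln_div)
      finally have L: "Re (Ln ((z - b) / (a - b))) = \<dots>" .
      have "Re (F z) = w a + C * Re (Ln ((z - b) / (a - b)))" by (simp add: F_def)
      then show ?thesis unfolding L by (simp add: w_def algebra_simps)
    qed
    then have "cmean w a r = cmean (\<lambda>z. Re (F z)) a r"
      using \<open>0 < r\<close> by (intro cmean_cong) auto
    also have "\<dots> = Re (F a)"
      unfolding F_def using \<open>0 < r\<close> mem \<open>a \<noteq> b\<close>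
      by (intro cmean_Re_holomorphic holomorphic_intros) auto
    also have "\<dots> = w a" using \<open>a \<noteq> b\<close> by (simp add: F_def)
    finally show ?thesis by simp
  qed
  have "continuous_on S w"
    unfolding w_def using assms False by (intro continuous_intros) auto
  then have "locally_supermean S w"
    unfolding locally_supermean_def
  proof (intro conjI ballI)
    fix a assume "a \<in> S"
    then have "a \<noteq> b" using assms by auto
    with * show "\<exists>r0>0. \<forall>r. 0 < r \<and> r < r0 \<longrightarrow> cmean w a r \<le> w a"
      by (intro exI[of _ "cmod (a - b)"]) auto
  qed
  then show ?thesis by (simp add: w_def[abs_def])
qed

lemma usc_bounded_above:
  assumes "compact C" "usc_on C h" "\<forall>z\<in>C. h z < \<infinity>"
  shows "\<exists>M. \<forall>z\<in>C. h z \<le> ereal M"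
proof (cases "C = {}")
  case False
  then obtain a where a: "a \<in> C" "\<forall>z\<in>C. h z \<le> h a"
    using usc_attains_sup assms by blast
  then have "h a < \<infinity>" using assms by blast
  then obtain M where "h a \<le> ereal M" by (cases "h a") auto
  then show ?thesis using a order_trans by blast
qed auto

text \<open>Both barrier arguments below end with this: the comparison function has a free factor
  \<open>C\<close>, and where its slope \<open>l\<close> is negative, letting \<open>C\<close> grow
  leaves only -\<infinity>.\<close>

lemma ereal_eq_minus_infty:
  fixes x :: ereal
  assumes "l < 0" and le: "\<And>C. C > 0 \<Longrightarrow> x \<le> ereal (M + C * l)"
  shows "x = -\<infinity>"
proof -
  have "x \<le> ereal K" for K
  proof -
    define C where "C = max 1 ((K - M) / l)"
    have "C * l \<le> (K - M) / l * l"
      using \<open>l < 0\<close> by (intro mult_right_mono_neg) (auto simp: C_def)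
    then have "M + C * l \<le> K" using \<open>l < 0\<close> by simp
    moreover have "C > 0" by (simp add: C_def)
    ultimately show ?thesis using le[of C] by (meson ereal_less_eq(3) order_trans)
  qed
  then show ?thesis by (simp add: ereal_bot)
qed

text \<open>The barrier M + C ln (|z - b| / R) equals the upper bound \<open>M\<close> on the outer
  circle. Near the inner circle \<open>h\<close> is -\<infinity>, so any multiple \<open>C\<close>
  is admissible, and between the circles the logarithm is negative.\<close>

lemma submean_minus_infty_ball:
  assumes h: "locally_submean W h" and "cball b R \<subseteq> W" and "0 < s"
    and ninf: "\<And>z. z \<in> ball b s \<Longrightarrow> h z = -\<infinity>"
    and z: "z \<in> ball b R"
  shows "h z = -\<infinity>"
proof (cases "z \<in> ball b s")
  case False
  have "s < R" using z False by (auto simp: dist_norm)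
  have "usc_on (cball b R) h" "\<forall>z\<in>cball b R. h z < \<infinity>"
    using locally_submean_subset[OF h assms(2)] by (auto simp: locally_submean_def)
  then obtain M where M: "\<And>z. z \<in> cball b R \<Longrightarrow> h z \<le> ereal M"
    using usc_bounded_above[OF compact_cball] by blast
  \<comment> \<open>The radius s/2 keeps the inner frontier circle inside the open ball where
    \<open>h\<close> is -\<infinity>.\<close>
  define D where "D = ball b R - cball b (s/2)"
  have "z \<in> D" using z False \<open>0 < s\<close> by (auto simp: D_def)
  have "open D" by (auto simp: D_def)
  have bound: "h z \<le> ereal (M + C * ln (cmod (z - b) / R))" if "C > 0" for C
  proof (rule max_principle[where D = D and h = h and z = z and w = "\<lambda>z. M + C * ln (cmod (z - b) / R)"])
    show "open D" "bounded D" by (auto simp: D_def intro: bounded_subset[OF bounded_ball])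
    show "locally_submean D h"
      by (rule locally_submean_subset[OF h]) (use assms(2) in \<open>auto simp: D_def subset_iff\<close>)
    show "locally_supermean D (\<lambda>z. M + C * ln (cmod (z - b) / R))"
      by (rule locally_supermean_ln) (use \<open>0 < s\<close> in \<open>auto simp: D_def\<close>)
    show "z \<in> D" by fact
  next
    fix y and \<epsilon> :: real assume y: "y \<in> frontier D" and "\<epsilon> > 0"
    have "closure D \<subseteq> cball b R - ball b (s/2)"
      by (rule closure_minimal) (auto simp: D_def)
    then have "y \<in> cball b R - ball b (s/2)" "y \<notin> D"
      using y interior_open[OF \<open>open D\<close>] unfolding frontier_def by auto
    then have "dist b y = R \<or> dist b y < s"
      using \<open>0 < s\<close> \<open>s < R\<close> by (auto simp: D_def)
    then consider "dist b y = R" | "y \<in> ball b s" by auto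
    then show "\<exists>T. open T \<and> y \<in> T \<and> (\<forall>x\<in>T \<inter> D. h x \<le> ereal (M + C * ln (cmod (x - b) / R) + \<epsilon>))"
    proof cases
      case 1
      define w where "w x = M + C * ln (cmod (x - b) / R)" for x
      have "y \<noteq> b" using 1 \<open>0 < s\<close> \<open>s < R\<close> by auto
      then have "isCont w y"
        unfolding w_def using \<open>0 < s\<close> \<open>s < R\<close> by (intro continuous_intros) auto
      moreover have "w y = M"
        using 1 \<open>0 < s\<close> \<open>s < R\<close> by (simp add: w_def dist_norm norm_minus_commute)
      ultimately have "\<forall>\<^sub>F x in nhds y. M - \<epsilon> < w x"
        using \<open>\<epsilon> > 0\<close> unfolding isCont_def tendsto_at_iff_tendsto_nhds
        by (intro order_tendstoD(1)[of w "w y"]) simp_all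
      then obtain T where "open T" "y \<in> T" "\<forall>x\<in>T. M - \<epsilon> < w x"
        unfolding eventually_nhds by blast
      moreover from this have "\<forall>x\<in>T \<inter> D. h x \<le> ereal (w x + \<epsilon>)"
      proof (intro ballI)
        fix x assume "x \<in> T \<inter> D"
        then have "h x \<le> ereal M" "ereal M \<le> ereal (w x + \<epsilon>)"
          using M \<open>\<forall>x\<in>T. M - \<epsilon> < w x\<close> by (auto simp: D_def)
        then show "h x \<le> ereal (w x + \<epsilon>)" by (rule order_trans)
      qed
      ultimately show ?thesis unfolding w_def by (intro exI[of _ T]) simp
    next
      case 2
      then show ?thesis using ninf by (intro exI[of _ "ball b s"]) auto
    qed
  qed
  have "ln (cmod (z - b) / R) < 0"
  proof (rule ln_less_zero)
    have "0 < cmod (z - b)" "cmod (z - b) < R"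
      using z False \<open>0 < s\<close> by (auto simp: dist_norm norm_minus_commute)
    then show "0 < cmod (z - b) / R" "cmod (z - b) / R < 1"
      using \<open>0 < s\<close> \<open>s < R\<close> by simp_all
  qed
  then show ?thesis by (rule ereal_eq_minus_infty[OF _ bound])
qed (use ninf in blast)

lemma submean_minus_infty_connected:
  assumes h: "locally_submean W h" and "open W" "connected W"
    and O: "open O'" "O' \<noteq> {}" "O' \<subseteq> W" "\<And>z. z \<in> O' \<Longrightarrow> h z = -\<infinity>"
    and "z \<in> W"
  shows "h z = -\<infinity>"
proof -
  define Z where "Z = interior {z\<in>W. h z = -\<infinity>}"
  have ZW: "Z \<subseteq> W" and Z: "\<And>z. z \<in> Z \<Longrightarrow> h z = -\<infinity>"
    using interior_subset Z_def by auto
  have "O' \<subseteq> Z" unfolding Z_def using O by (intro interior_maximal) auto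
  have "openin (top_of_set W) Z"
    using ZW by (simp add: open_subset Z_def)
  moreover have "closedin (top_of_set W) Z"
  proof -
    have "y \<in> Z" if y: "y \<in> W" "y \<in> closure Z" for y
    proof -
      obtain R where R: "R > 0" "cball y R \<subseteq> W"
        using y \<open>open W\<close> open_contains_cball by blast
      \<comment> \<open>The ball to be filled is centred at a nearby point of \<open>Z\<close>,
        where a small ball of poles is available; radius R/2 still reaches \<open>y\<close> and
        stays in \<open>W\<close>.\<close>
      obtain b where b: "b \<in> Z" "dist b y < R/2"
        using y(2) R(1) closure_approachable[of y Z] by (metis half_gt_zero)
      have sub: "cball b (R/2) \<subseteq> W"
      proof (rule order_trans[OF _ R(2)], rule subsetI)
        fix x assume "x \<in> cball b (R/2)"
        then show "x \<in> cball y R" using b dist_triangle[of y x b] by (simp add: dist_commute)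
      qed
      have "open Z" by (simp add: Z_def)
      then obtain s where s: "s > 0" "ball b s \<subseteq> Z" using b open_contains_ball by blast
      have "h x = -\<infinity>" if "x \<in> ball b (R/2)" for x
        using submean_minus_infty_ball[OF h sub s(1) _ that] s(2) Z by blast
      then have "ball b (R/2) \<subseteq> Z"
        unfolding Z_def using sub by (intro interior_maximal) auto
      then show ?thesis using b by auto
    qed
    then have "\<forall>y. y islimpt Z \<and> y \<in> W \<longrightarrow> y \<in> Z" unfolding closure_def by blast
    then show ?thesis using ZW by (simp add: closedin_limpt)
  qed
  ultimately have "Z = {} \<or> Z = W"
    using \<open>connected W\<close> connected_clopen by blast
  then show ?thesis using \<open>O' \<subseteq> Z\<close> O(2) \<open>z \<in> W\<close> Z by auto
qed

text \<open>
  Given a separation of the complement of the pole set, replacing \<open>h\<close> by \<open>-\<infinity>\<close> outside one of the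
  two parts keeps the local sub-mean value property, so that the identity principle applies.
\<close>
lemma locally_submean_restrict:
  assumes h: "locally_submean Q h" and "open A" "open B" "A \<inter> B = {}"
    and Q: "\<And>z. z \<in> Q \<Longrightarrow> h z \<noteq> -\<infinity> \<Longrightarrow> z \<in> A \<union> B"
  shows "locally_submean Q (\<lambda>z. if z \<in> A then h z else -\<infinity>)" (is "locally_submean Q ?g")
  unfolding locally_submean_def
proof (intro conjI)
  have usc: "usc_on Q h" using h by (simp add: locally_submean_def)
  show "usc_on Q ?g"
    unfolding usc_on_def
  proof (intro ballI allI impI)
    fix x y assume x: "x \<in> Q" and y: "?g x < y"
    have le: "?g z \<le> h z" for z by auto
    \<comment> \<open>If \<open>h x < y\<close> fails, then \<open>x\<close> is not in
      \<open>A\<close>, and \<open>h x\<close> is not -\<infinity> because \<open>y\<close> is not.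
      Hence \<open>x\<close> lies in the open set \<open>B\<close>, on which the restricted function
      is constantly -\<infinity>.\<close>
    have "h x < y \<or> x \<in> B"
      using y Q[OF x] by (cases "x \<in> A"; cases "h x = -\<infinity>") auto
    then consider "h x < y" | "x \<in> B" by blast
    then show "\<forall>\<^sub>F z in at x within Q. ?g z < y"
    proof cases
      case 1
      then have "\<forall>\<^sub>F z in at x within Q. h z < y" using usc x unfolding usc_on_def by blast
      then show ?thesis by eventually_elim (use le order_le_less_trans in blast)
    next
      case 2
      then have "\<forall>\<^sub>F z in at x within Q. z \<in> B"
        using \<open>open B\<close> by (auto simp: eventually_at_topological)
      then show ?thesis
      proof eventually_elim
        case (elim z)
        then have "z \<notin> A" "x \<notin> A" using \<open>A \<inter> B = {}\<close> 2 by auto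
        then show ?case using y by simp
      qed
    qed
  qed
  show "\<forall>z\<in>Q. ?g z < \<infinity>" using h by (auto simp: locally_submean_def)
  show "\<forall>a\<in>Q. \<exists>r0>0. \<forall>r g. 0 < r \<and> r < r0 \<and> continuous_on (sphere a r) g \<and>
        (\<forall>z\<in>sphere a r. ?g z \<le> ereal (g z)) \<longrightarrow> ?g a \<le> ereal (cmean g a r)"
  proof
    fix a assume a: "a \<in> Q"
    show "\<exists>r0>0. \<forall>r g. 0 < r \<and> r < r0 \<and> continuous_on (sphere a r) g \<and>
        (\<forall>z\<in>sphere a r. ?g z \<le> ereal (g z)) \<longrightarrow> ?g a \<le> ereal (cmean g a r)"
    proof (cases "a \<in> A")
      case True
      obtain r1 where r1: "r1 > 0" "\<And>r g. \<lbrakk>0 < r; r < r1; continuous_on (sphere a r) g;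
           \<forall>z\<in>sphere a r. h z \<le> ereal (g z)\<rbrakk> \<Longrightarrow> h a \<le> ereal (cmean g a r)"
        using h a unfolding locally_submean_def by metis
      obtain r2 where r2: "r2 > 0" "ball a r2 \<subseteq> A" using True \<open>open A\<close> open_contains_ball by blast
      have "?g a \<le> ereal (cmean g a r)" if "0 < r \<and> r < min r1 r2 \<and> continuous_on (sphere a r) g \<and>
        (\<forall>z\<in>sphere a r. ?g z \<le> ereal (g z))" for r g
      proof -
        have "sphere a r \<subseteq> A" using r2(2) that by (auto simp: subset_iff)
        have "h z \<le> ereal (g z)" if z: "z \<in> sphere a r" for z
        proof -
          have "?g z \<le> ereal (g z)" using \<open>0 < r \<and> _\<close> z by blast
          moreover have "z \<in> A" using \<open>sphere a r \<subseteq> A\<close> z by blast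
          ultimately show ?thesis by simp
        qed
        then have "h a \<le> ereal (cmean g a r)" using that by (intro r1(2)) auto
        then show ?thesis using True by simp
      qed
      moreover have "min r1 r2 > 0" using r1(1) r2(1) by simp
      ultimately show ?thesis by blast
    qed (auto intro!: exI[of _ 1])
  qed
qed

text \<open>The function \<open>h\<close> with pole set \<open>P\<close> exists only near each
  point, so the identity principle is applied on small balls and the results are glued by
  connectedness of \<open>D\<close>: once to show that \<open>interior P \<inter> D\<close> is
  relatively clopen, and once to show that a separation of \<open>D - P\<close> would extend to one
  of \<open>D\<close>.\<close>

lemma complement_of_poles:
  assumes "open D" "connected D"
    and loc: "\<And>z. z \<in> D \<Longrightarrow> \<exists>N h. open N \<and> z \<in> N \<and> N \<subseteq> D \<and> locally_submean N h \<and>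
      P \<inter> N = {x\<in>N. h x = -\<infinity>}"
    and "closed P"
  shows "D \<subseteq> P \<or> connected (D - P) \<and> interior P \<inter> D = {}"
proof -
  have loc': "\<exists>e>0. ball z e \<subseteq> D \<and> (\<exists>h. locally_submean (ball z e) h \<and>
      (\<forall>x\<in>ball z e. x \<in> P \<longleftrightarrow> h x = -\<infinity>))" if z: "z \<in> D" for z
  proof -
    obtain N h where N: "open N" "z \<in> N" "N \<subseteq> D" "locally_submean N h" "P \<inter> N = {x\<in>N. h x = -\<infinity>}"
      using loc[OF z] by blast
    then obtain e where e: "e > 0" "ball z e \<subseteq> N" using open_contains_ball by blast
    then show ?thesis
      using N by (intro exI[of _ e] conjI exI[of _ h] locally_submean_subset[OF N(4)]) auto
  qed
  have whole: "ball z e \<subseteq> P" if "locally_submean (ball z e) h" "\<forall>x\<in>ball z e. x \<in> P \<longleftrightarrow> h x = -\<infinity>"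
    "O' \<subseteq> ball z e" "open O'" "O' \<noteq> {}" "O' \<subseteq> P" for z e h O'
  proof
    fix y assume "y \<in> ball z e"
    have "h y = -\<infinity>"
    proof (rule submean_minus_infty_connected[OF that(1) _ _ that(4,5,3)])
      show "h x = -\<infinity>" if "x \<in> O'" for x
        using that \<open>O' \<subseteq> ball z e\<close> \<open>O' \<subseteq> P\<close> \<open>\<forall>x\<in>ball z e. x \<in> P \<longleftrightarrow> h x = -\<infinity>\<close> by blast
    qed (use \<open>y \<in> ball z e\<close> in auto)
    then show "y \<in> P" using that \<open>y \<in> ball z e\<close> by blast
  qed
  define Z where "Z = interior P \<inter> D"
  have "openin (top_of_set D) Z" by (auto simp: Z_def openin_open)
  moreover have "closedin (top_of_set D) Z"
  proof -
    have "y \<in> Z" if y: "y \<in> D" "y \<in> closure Z" for y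
    proof -
      obtain e h where e: "e > 0" "ball y e \<subseteq> D" "locally_submean (ball y e) h"
        "\<forall>x\<in>ball y e. x \<in> P \<longleftrightarrow> h x = -\<infinity>" using loc'[OF y(1)] by blast
      have "ball y e \<inter> Z \<noteq> {}"
        using y(2) e(1) by (metis centre_in_ball open_Int_closure_eq_empty open_ball disjoint_iff)
      moreover have "open (ball y e \<inter> Z)" "ball y e \<inter> Z \<subseteq> P"
        using \<open>open D\<close> interior_subset by (auto simp: Z_def)
      ultimately have "ball y e \<subseteq> P"
        by (intro whole[OF e(3,4), of "ball y e \<inter> Z"]) auto
      then have "ball y e \<subseteq> interior P" by (intro interior_maximal) auto
      then show ?thesis using e(1) y by (auto simp: Z_def)
    qed
    then have "\<forall>y. y islimpt Z \<and> y \<in> D \<longrightarrow> y \<in> Z" unfolding closure_def by blast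
    moreover have "Z \<subseteq> D" by (simp add: Z_def)
    ultimately show ?thesis by (simp add: closedin_limpt)
  qed
  ultimately consider "Z = D" | "Z = {}"
    using \<open>connected D\<close> connected_clopen by blast
  then show ?thesis
  proof cases
    case 1
    then show ?thesis using interior_subset by (auto simp: Z_def)
  next
    case 2
    have "connected (D - P)"
    proof (rule connectedI)
      fix A0 B0 assume A0: "open A0" "open B0" "A0 \<inter> (D - P) \<noteq> {}" "B0 \<inter> (D - P) \<noteq> {}"
        "A0 \<inter> B0 \<inter> (D - P) = {}" "D - P \<subseteq> A0 \<union> B0"
      define A B where "A = A0 \<inter> (D - P)" and "B = B0 \<inter> (D - P)"
      have AB: "open A" "open B" "A \<inter> B = {}" "A \<noteq> {}" "B \<noteq> {}" "A \<union> B = D - P"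
        using A0 \<open>open D\<close> \<open>closed P\<close> by (auto simp: A_def B_def)
      have dich: "\<exists>e>0. ball z e \<subseteq> D \<and> (ball z e \<inter> A = {} \<or> ball z e \<inter> B = {})" if z: "z \<in> D" for z
      proof -
        obtain e h where e: "e > 0" "ball z e \<subseteq> D" "locally_submean (ball z e) h"
          "\<forall>x\<in>ball z e. x \<in> P \<longleftrightarrow> h x = -\<infinity>" using loc'[OF z] by blast
        define g where "g x = (if x \<in> A then h x else -\<infinity>)" for x
        have g: "locally_submean (ball z e) g"
          unfolding g_def using AB e by (intro locally_submean_restrict[OF e(3) AB(1-3)]) auto
        have "ball z e \<inter> A = {}" if B: "ball z e \<inter> B \<noteq> {}"
        proof -
          have "g x = -\<infinity>" if "x \<in> ball z e" for x
            by (rule submean_minus_infty_connected[OF g _ _ _ B _ _ that])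
              (use AB in \<open>auto simp: g_def\<close>)
          then have "h x = -\<infinity>" if "x \<in> ball z e \<inter> A" for x
            using that unfolding g_def by (metis IntD1 IntD2)
          then show ?thesis using e AB(6) by blast
        qed
        then show ?thesis using e by blast
      qed
      \<comment> \<open>These sets extend \<open>A\<close> and \<open>B\<close> across
        \<open>P\<close>: a point goes to the side that its small balls may still meet. By
        \<open>dich\<close> they cover \<open>D\<close>, and they are disjoint because a ball in
        \<open>D\<close> missing both \<open>A\<close> and \<open>B\<close> would lie in
        \<open>P\<close>.\<close>
      define A' B' where "A' = {z\<in>D. \<exists>e>0. ball z e \<subseteq> D \<and> ball z e \<inter> B = {}}"
        and "B' = {z\<in>D. \<exists>e>0. ball z e \<subseteq> D \<and> ball z e \<inter> A = {}}"
      have opn: "open {z\<in>D. \<exists>e>0. ball z e \<subseteq> D \<and> ball z e \<inter> S = {}}" for S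
      proof -
        have "{z\<in>D. \<exists>e>0. ball z e \<subseteq> D \<and> ball z e \<inter> S = {}} = interior (D - S)"
        proof (rule set_eqI)
          fix z
          have "ball z e \<subseteq> D - S \<longleftrightarrow> ball z e \<subseteq> D \<and> ball z e \<inter> S = {}" for e by blast
          moreover have "z \<in> ball z e" if "e > 0" for e using that by simp
          ultimately show "z \<in> {z\<in>D. \<exists>e>0. ball z e \<subseteq> D \<and> ball z e \<inter> S = {}} \<longleftrightarrow> z \<in> interior (D - S)"
            unfolding mem_interior mem_Collect_eq by blast
        qed
        then show ?thesis by simp
      qed
      have "A' \<inter> B' = {}"
      proof (rule ccontr)
        assume "A' \<inter> B' \<noteq> {}"
        then obtain z e e' where *: "z \<in> D" "e > 0" "e' > 0" "ball z e \<subseteq> D" "ball z e \<inter> B = {}"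
          "ball z e' \<inter> A = {}" by (auto simp: A'_def B'_def)
        have "ball z (min e e') \<subseteq> ball z e" "ball z (min e e') \<subseteq> ball z e'" by auto
        then have "ball z (min e e') \<subseteq> P" using AB(6) *(4-6) by blast
        then have "z \<in> interior P" using * by (auto simp: mem_interior intro!: exI[of _ "min e e'"])
        then show False using 2 * by (auto simp: Z_def)
      qed
      moreover have "A \<subseteq> A'"
      proof
        fix x assume "x \<in> A"
        then obtain e where "e > 0" "ball x e \<subseteq> A" using AB open_contains_ball by blast
        moreover from this have "ball x e \<subseteq> D" "ball x e \<inter> B = {}" using AB(3,6) by blast+
        ultimately show "x \<in> A'" using AB(6) \<open>x \<in> A\<close> unfolding A'_def by blast
      qed
      moreover have "B \<subseteq> B'"
      proof
        fix x assume "x \<in> B"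
        then obtain e where "e > 0" "ball x e \<subseteq> B" using AB open_contains_ball by blast
        moreover from this have "ball x e \<subseteq> D" "ball x e \<inter> A = {}" using AB(3,6) by blast+
        ultimately show "x \<in> B'" using AB(6) \<open>x \<in> B\<close> unfolding B'_def by blast
      qed
      moreover have "open A'" "open B'" unfolding A'_def B'_def by (rule opn)+
      moreover have "D \<subseteq> A' \<union> B'" using dich unfolding A'_def B'_def by blast
      ultimately show False
        using connectedD[OF \<open>connected D\<close>, of A' B'] AB by (auto simp: A'_def B'_def)
    qed
    then show ?thesis using 2 by (simp add: Z_def)
  qed
qed


section \<open>Poisson integrals\<close>

lemma set_integral_mono_subset:
  fixes f :: "'a \<Rightarrow> real"
  assumes "set_integrable M A f" "set_integrable M B f" "A \<subseteq> B" "\<And>x. f x \<ge> 0"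
  shows "(LINT x:A|M. f x) \<le> (LINT x:B|M. f x)"
  using assms unfolding set_lebesgue_integral_def set_integrable_def
  by (intro integral_mono) (auto simp: indicator_def)

text \<open>Written as the real part of a function holomorphic in \<open>z\<close>, so that its mean
  value property is immediate; \<open>poisson_kernel_eq\<close> is the form used for
  estimates.\<close>

definition poisson_kernel :: "complex \<Rightarrow> real \<Rightarrow> real" where
  "poisson_kernel z t = Re ((cis t + z) / (cis t - z))"

lemma poisson_kernel_eq: "poisson_kernel z t = (1 - (cmod z)\<^sup>2) / (cmod (cis t - z))\<^sup>2"
proof -
  have "(cos t + Re z) * (cos t - Re z) + (sin t + Im z) * (sin t - Im z) =
      ((cos t)\<^sup>2 + (sin t)\<^sup>2) - ((Re z)\<^sup>2 + (Im z)\<^sup>2)"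
    by (simp add: algebra_simps power2_eq_square)
  then show ?thesis
    by (simp add: poisson_kernel_def Re_divide cmod_power2)
qed

lemma poisson_kernel_nonneg: "cmod z \<le> 1 \<Longrightarrow> poisson_kernel z t \<ge> 0"
  unfolding poisson_kernel_eq by (intro divide_nonneg_nonneg) (auto simp: power_le_one)

lemma norm_cis_diff_ge: "cmod (cis t - z) \<ge> 1 - cmod z"
  using norm_triangle_ineq2[of "cis t" z] by simp

lemma poisson_kernel_le:
  assumes "cmod z \<le> \<rho>" "\<rho> < 1"
  shows "poisson_kernel z t \<le> 2 / (1 - \<rho>)\<^sup>2"
  unfolding poisson_kernel_eq
proof (rule frac_le)
  show "(1 - \<rho>)\<^sup>2 \<le> (cmod (cis t - z))\<^sup>2"
    using norm_cis_diff_ge[of z t] assms by (intro power_mono) auto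
  show "1 - (cmod z)\<^sup>2 \<le> 2" by (smt (verit) zero_le_power2)
qed (use assms in auto)

lemma abs_poisson_kernel_le:
  assumes "cmod z \<le> \<rho>" "\<rho> < 1"
  shows "\<bar>poisson_kernel z t\<bar> \<le> 2 / (1 - \<rho>)\<^sup>2"
  using poisson_kernel_nonneg[of z t] poisson_kernel_le[OF assms, of t] assms by simp

lemma cis_neq: "cmod z < 1 \<Longrightarrow> cis t \<noteq> z"
  by (metis norm_cis less_irrefl)

lemma cmean_poisson_kernel:
  assumes "cball a r \<subseteq> ball 0 1" "r > 0"
  shows "cmean (\<lambda>z. poisson_kernel z t) a r = poisson_kernel a t"
proof -
  have "cis t - z \<noteq> 0" if "z \<in> cball a r" for z
    using cis_neq[of z t] assms(1) that by (auto simp: subset_iff)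
  then show ?thesis
    unfolding poisson_kernel_def using assms(2)
    by (intro cmean_Re_holomorphic holomorphic_intros) auto
qed

lemma measurable_poisson_kernel [measurable]:
  assumes "f \<in> borel_measurable M" "g \<in> borel_measurable M"
  shows "(\<lambda>x. poisson_kernel (f x) (g x)) \<in> borel_measurable M"
proof -
  have [measurable]: "cis \<in> borel_measurable borel"
    by (intro borel_measurable_continuous_onI continuous_intros)
  note assms [measurable]
  show ?thesis unfolding poisson_kernel_def by measurable
qed

text \<open>The harmonic measure, seen from \<open>z\<close>, of the boundary points with angle in
  \<open>S\<close>.\<close>

definition poisson_integral :: "real set \<Rightarrow> complex \<Rightarrow> real" where
  "poisson_integral S z = (LINT t:S|lborel. poisson_kernel z t) / (2 * pi)"

lemma emeasure_angles_finite: "S \<subseteq> {0..2*pi} \<Longrightarrow> emeasure lborel S < \<infinity>"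
  using emeasure_mono[of S "{0..2*pi}" lborel] by (simp add: le_less_trans)

lemma poisson_integrable:
  assumes S: "S \<in> sets borel" "S \<subseteq> {0..2*pi}" and z: "cmod z < 1"
  shows "set_integrable lborel S (poisson_kernel z)"
  unfolding set_integrable_def
proof (rule integrableI_bounded_set[where A = S and B = "2 / (1 - cmod z)\<^sup>2"])
  show "S \<in> sets lborel" "emeasure lborel S < \<infinity>" using S emeasure_angles_finite by auto
  show "(\<lambda>t. indicat_real S t *\<^sub>R poisson_kernel z t) \<in> borel_measurable lborel"
    using S(1) by measurable
qed (use abs_poisson_kernel_le[of z "cmod z"] z in \<open>auto simp: indicator_def\<close>)

lemma poisson_integral_nonneg: "cmod z \<le> 1 \<Longrightarrow> poisson_integral S z \<ge> 0"
  unfolding poisson_integral_def set_lebesgue_integral_def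
  by (intro divide_nonneg_nonneg Bochner_Integration.integral_nonneg)
    (auto simp: poisson_kernel_nonneg)

text \<open>Dominated convergence on each closed disc of radius below 1, where the kernel has a
  bound that depends on the radius only.\<close>

lemma continuous_on_poisson_integral:
  assumes S: "S \<in> sets borel" "S \<subseteq> {0..2*pi}"
  shows "continuous_on (ball 0 1) (poisson_integral S)"
proof -
  have *: "continuous_on (cball 0 \<rho>) (poisson_integral S)" if \<rho>: "\<rho> < 1" for \<rho>
  proof (rule continuous_on_sequentiallyI)
    fix x :: "nat \<Rightarrow> complex" and z :: complex assume x: "\<forall>n. x n \<in> cball 0 \<rho>" and z: "z \<in> cball 0 \<rho>" and lim: "x \<longlonglongrightarrow> z"
    have "(\<lambda>n. LINT t|lborel. indicat_real S t *\<^sub>R poisson_kernel (x n) t) \<longlonglongrightarrow>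
        (LINT t|lborel. indicat_real S t *\<^sub>R poisson_kernel z t)"
    proof (rule integral_dominated_convergence[where w = "\<lambda>t. indicat_real S t *\<^sub>R (2 / (1 - \<rho>)\<^sup>2)"])
      show "(\<lambda>t. indicat_real S t *\<^sub>R poisson_kernel z t) \<in> borel_measurable lborel"
        "(\<lambda>t. indicat_real S t *\<^sub>R poisson_kernel (x n) t) \<in> borel_measurable lborel" for n
        using S(1) by measurable
      have "integrable lborel (indicat_real S)"
        using S(1) emeasure_angles_finite[OF S(2)] by (simp add: integrable_indicator_iff)
      then show "integrable lborel (\<lambda>t. indicat_real S t *\<^sub>R (2 / (1 - \<rho>)\<^sup>2))" by auto
      show "AE t in lborel. norm (indicat_real S t *\<^sub>R poisson_kernel (x n) t)
          \<le> indicat_real S t *\<^sub>R (2 / (1 - \<rho>)\<^sup>2)" for n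
        using abs_poisson_kernel_le[OF _ \<rho>, of "x n"] x by (auto simp: indicator_def)
      have "(\<lambda>n. poisson_kernel (x n) t) \<longlonglongrightarrow> poisson_kernel z t" for t
        unfolding poisson_kernel_def using cis_neq[of z t] z \<rho> by (intro tendsto_intros lim) auto
      then show "AE t in lborel. (\<lambda>n. indicat_real S t *\<^sub>R poisson_kernel (x n) t)
          \<longlonglongrightarrow> indicat_real S t *\<^sub>R poisson_kernel z t"
        by (auto intro!: tendsto_intros)
    qed
    then show "(\<lambda>n. poisson_integral S (x n)) \<longlonglongrightarrow> poisson_integral S z"
      unfolding poisson_integral_def set_lebesgue_integral_def by (intro tendsto_intros) auto
  qed
  show ?thesis
    unfolding continuous_on_eq_continuous_at[OF open_ball]
  proof
    fix z :: complex assume "z \<in> ball 0 1"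
    then obtain \<rho> where \<rho>: "cmod z < \<rho>" "\<rho> < 1" using dense[of "cmod z" 1] by auto
    have "continuous_on (ball 0 \<rho>) (poisson_integral S)"
      by (rule continuous_on_subset[OF *[OF \<rho>(2)]]) auto
    then show "isCont (poisson_integral S) z"
      using \<rho>(1) by (simp add: continuous_on_eq_continuous_at)
  qed
qed

lemma integral_eq_LINT_circle:
  fixes w :: "complex \<Rightarrow> real"
  assumes "continuous_on (sphere a r) w" "r \<ge> 0"
  shows "integral {0..2*pi} (\<lambda>t. w (a + of_real r * cis t)) =
    (LINT t:{0..2*pi}|lborel. w (a + of_real r * cis t))"
  by (intro set_borel_integral_eq_integral(2)[symmetric] borel_integrable_atLeastAtMost'
      continuous_on_circle assms)

text \<open>Used with two different sets \<open>K\<close>: the full interval for the mean value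
  property of the Poisson integral, and the given compact set for the averaging in
  \<open>poisson_integral_small\<close>.\<close>

lemma poisson_fubini:
  assumes S: "S \<in> sets borel" "S \<subseteq> {0..2*pi}" and K: "K \<in> sets borel" "K \<subseteq> {0..2*pi}"
    and "cball a r \<subseteq> ball 0 1" "r > 0"
  shows "(LINT \<theta>:K|lborel. LINT t:S|lborel. poisson_kernel (a + of_real r * cis \<theta>) t) =
    (LINT t:S|lborel. LINT \<theta>:K|lborel. poisson_kernel (a + of_real r * cis \<theta>) t)"
proof -
  have "compact (sphere a r)" "continuous_on (sphere a r) cmod"
    by (auto intro: continuous_intros)
  moreover have "sphere a r \<noteq> {}" using \<open>r > 0\<close> by simp
  ultimately obtain b where b: "b \<in> sphere a r" "\<And>z. z \<in> sphere a r \<Longrightarrow> cmod z \<le> cmod b"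
    using continuous_attains_sup by metis
  then have "cmod b < 1" using assms(5) by (auto simp: subset_iff)
  have [measurable]: "(\<lambda>\<theta>. a + of_real r * cis \<theta>) \<in> borel_measurable borel"
    by (intro borel_measurable_continuous_onI continuous_intros)
  note S(1)[measurable] K(1)[measurable]
  define f where "f \<theta> t = indicat_real K \<theta> *\<^sub>R (indicat_real S t *\<^sub>R poisson_kernel (a + of_real r * cis \<theta>) t)" for \<theta> t
  have "integrable (lborel \<Otimes>\<^sub>M lborel) (\<lambda>(\<theta>, t). f \<theta> t)"
  proof (rule integrableI_bounded_set[where A = "K \<times> S" and B = "2 / (1 - cmod b)\<^sup>2"])
    show "K \<times> S \<in> sets (lborel \<Otimes>\<^sub>M lborel)" using S(1) K(1) by auto
    show "emeasure (lborel \<Otimes>\<^sub>M lborel) (K \<times> S) < \<infinity>"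
      using S(1) K(1) emeasure_angles_finite[OF S(2)] emeasure_angles_finite[OF K(2)]
      by (simp add: lborel.emeasure_pair_measure_Times ennreal_mult_less_top)
    show "(\<lambda>(\<theta>, t). f \<theta> t) \<in> borel_measurable (lborel \<Otimes>\<^sub>M lborel)"
      unfolding f_def by measurable
    have "\<bar>poisson_kernel (a + of_real r * cis \<theta>) t\<bar> \<le> 2 / (1 - cmod b)\<^sup>2" for \<theta> t
      using b(2)[OF circle_in_sphere] \<open>r > 0\<close> \<open>cmod b < 1\<close> by (intro abs_poisson_kernel_le) auto
    then show "AE x in lborel \<Otimes>\<^sub>M lborel. x \<in> K \<times> S \<longrightarrow>
        norm (case x of (\<theta>, t) \<Rightarrow> f \<theta> t) \<le> 2 / (1 - cmod b)\<^sup>2"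
      by (auto simp: f_def indicator_def)
    show "AE x in lborel \<Otimes>\<^sub>M lborel. x \<notin> K \<times> S \<longrightarrow> (case x of (\<theta>, t) \<Rightarrow> f \<theta> t) = 0"
      by (auto simp: f_def indicator_def)
  qed
  then have "(LINT t|lborel. LINT \<theta>|lborel. f \<theta> t) = (LINT \<theta>|lborel. LINT t|lborel. f \<theta> t)"
    by (rule lborel_pair.Fubini_integral)
  moreover have "(LINT t|lborel. LINT \<theta>|lborel. f \<theta> t) =
      (LINT t:S|lborel. LINT \<theta>:K|lborel. poisson_kernel (a + of_real r * cis \<theta>) t)"
    unfolding set_lebesgue_integral_def f_def
    by (simp add: mult.left_commute flip: integral_mult_right_zero)
  moreover have "(LINT \<theta>|lborel. LINT t|lborel. f \<theta> t) =
      (LINT \<theta>:K|lborel. LINT t:S|lborel. poisson_kernel (a + of_real r * cis \<theta>) t)"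
    unfolding set_lebesgue_integral_def f_def by simp
  ultimately show ?thesis by simp
qed

lemma continuous_on_poisson_kernel:
  "continuous_on (ball 0 1) (\<lambda>z. poisson_kernel z t)"
  unfolding poisson_kernel_def by (intro continuous_intros) (auto dest: cis_neq)

lemma cmean_poisson_integral:
  assumes S: "S \<in> sets borel" "S \<subseteq> {0..2*pi}" and ar: "cball a r \<subseteq> ball 0 1" "r > 0"
  shows "cmean (poisson_integral S) a r = poisson_integral S a"
proof -
  have sph: "sphere a r \<subseteq> ball 0 1" using ar(1) by (auto simp: subset_iff)
  have "integral {0..2*pi} (\<lambda>\<theta>. poisson_integral S (a + of_real r * cis \<theta>)) =
      (LINT \<theta>:{0..2*pi}|lborel. poisson_integral S (a + of_real r * cis \<theta>))"
    using ar(2) by (intro integral_eq_LINT_circle continuous_on_subset[OF continuous_on_poisson_integral[OF S] sph]) auto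
  also have "\<dots> = (LINT \<theta>:{0..2*pi}|lborel. LINT t:S|lborel. poisson_kernel (a + of_real r * cis \<theta>) t) / (2*pi)"
    by (simp add: poisson_integral_def)
  also have "\<dots> = (LINT t:S|lborel. LINT \<theta>:{0..2*pi}|lborel. poisson_kernel (a + of_real r * cis \<theta>) t) / (2*pi)"
    by (subst poisson_fubini[OF S _ _ ar]) auto
  also have "(LINT t:S|lborel. LINT \<theta>:{0..2*pi}|lborel. poisson_kernel (a + of_real r * cis \<theta>) t) =
      (LINT t:S|lborel. 2 * pi * poisson_kernel a t)"
  proof -
    have "(LINT \<theta>:{0..2*pi}|lborel. poisson_kernel (a + of_real r * cis \<theta>) t) =
        2 * pi * cmean (\<lambda>z. poisson_kernel z t) a r" for t
      unfolding cmean_def using ar(2)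
      by (subst integral_eq_LINT_circle)
        (auto intro: continuous_on_subset[OF continuous_on_poisson_kernel sph])
    then show ?thesis by (simp add: cmean_poisson_kernel[OF ar])
  qed
  finally show ?thesis
    by (simp add: cmean_def poisson_integral_def)
qed

section \<open>Boundary estimates for harmonic measure\<close>

lemma norm_cis_diff_le: "cmod (cis s - cis t) \<le> \<bar>s - t\<bar>"
proof -
  have "cmod (cis s - cis t) = 2 * \<bar>sin ((s - t) / 2)\<bar>"
  proof -
    have "(cmod (cis s - cis t))\<^sup>2 = 2 - 2 * cos (s - t)"
      unfolding cmod_power2 by (simp add: cos_diff power2_diff) 
        (smt (verit) sin_cos_squared_add2)
    also have "s - t = 2 * ((s - t) / 2)" by simp
    also have "2 - 2 * cos (2 * ((s - t) / 2)) = (2 * \<bar>sin ((s - t) / 2)\<bar>)\<^sup>2"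
      unfolding cos_double_sin by (simp add: power_mult_distrib)
    finally show ?thesis by (rule power2_eq_imp_eq) auto
  qed
  also have "\<dots> \<le> 2 * \<bar>(s - t) / 2\<bar>" by (intro mult_left_mono abs_sin_x_le_abs_x) auto
  finally show ?thesis by simp
qed

text \<open>An arc of length \<alpha> (1 - s) near \<open>cis \<phi>\<close> belongs to
  \<open>S\<close>, and on it the kernel is at least 1 / (4 (1 - s)). The product \<alpha> / 4 no
  longer depends on \<open>s\<close>; division by 2 pi gives the constant.\<close>

lemma poisson_integral_ge:
  assumes S: "S \<in> sets borel" "S \<subseteq> {0..2*pi}" and s: "0 \<le> s" "s < 1" and \<phi>: "\<phi> \<in> {0..2*pi}"
    and \<alpha>: "0 < \<alpha>" "\<alpha> < 1"
    and near: "\<And>t. t \<in> {0..2*pi} \<Longrightarrow> cmod (cis t - cis \<phi>) < \<alpha> * (1 - s) \<Longrightarrow> t \<in> S"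
  shows "poisson_integral S (of_real s * cis \<phi>) \<ge> \<alpha> / (8 * pi)"
proof -
  define z where "z = complex_of_real s * cis \<phi>"
  have z: "cmod z = s" using s by (simp add: z_def norm_mult)
  define l where "l = \<alpha> * (1 - s)"
  have "l > 0" "l \<le> 1" "l \<le> 1 - s" using \<alpha> s by (auto simp: l_def mult_le_one mult_le_cancel_right1)
  \<comment> \<open>The interval is one-sided and points towards the middle of
    \<open>{0..2*pi}\<close>, so that it does not wrap around the ends; this works because its
    length is at most 1.\<close>
  have "\<exists>I. I \<in> sets borel \<and> I \<subseteq> {0..2*pi} \<and> emeasure lborel I = l \<and> (\<forall>t\<in>I. \<bar>t - \<phi>\<bar> < l)"
  proof (cases "\<phi> \<le> pi")
    case True
    then show ?thesis using \<phi> \<open>l > 0\<close> \<open>l \<le> 1\<close> pi_gt3 by (intro exI[of _ "{\<phi>..<\<phi>+l}"]) auto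
  next
    case False
    then show ?thesis using \<phi> \<open>l > 0\<close> \<open>l \<le> 1\<close> pi_gt3 by (intro exI[of _ "{\<phi>-l<..\<phi>}"]) auto
  qed
  then obtain I where I: "I \<in> sets borel" "I \<subseteq> {0..2*pi}" "emeasure lborel I = l" "\<And>t. t \<in> I \<Longrightarrow> \<bar>t - \<phi>\<bar> < l"
    by blast
  have "I \<subseteq> S"
    using I(2,4) near norm_cis_diff_le unfolding l_def by (meson order_le_less_trans subset_iff)
  have ker: "poisson_kernel z t \<ge> 1 / (4 * (1 - s))" if "t \<in> I" for t
  proof -
    have "cmod (cis t - z) \<le> cmod (cis t - cis \<phi>) + cmod (cis \<phi> - z)"
      using norm_triangle_ineq[of "cis t - cis \<phi>" "cis \<phi> - z"] by simp
    also have "cis \<phi> - z = of_real (1 - s) * cis \<phi>" by (simp add: z_def algebra_simps)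
    also have "cmod (of_real (1 - s) * cis \<phi>) = 1 - s" using s by (simp add: norm_mult del: of_real_diff)
    also have "cmod (cis t - cis \<phi>) \<le> 1 - s"
      using norm_cis_diff_le[of t \<phi>] I(4)[OF that] \<open>l \<le> 1 - s\<close> by linarith
    finally have "cmod (cis t - z) \<le> 2 * (1 - s)" by simp
    then have le: "(cmod (cis t - z))\<^sup>2 \<le> (2 * (1 - s))\<^sup>2" by (intro power_mono) auto
    have pos: "cmod (cis t - z) > 0" using norm_cis_diff_ge[of z t] z s by linarith
    have "1 / (4 * (1 - s)) \<le> (1 + s) / (4 * (1 - s))" using s by (intro divide_right_mono) auto
    also have "\<dots> = (1 - s\<^sup>2) / (2 * (1 - s))\<^sup>2"
    proof -
      have "1 - s\<^sup>2 = (1 - s) * (1 + s)" "(2 * (1 - s))\<^sup>2 = (1 - s) * (4 * (1 - s))"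
        by (simp_all add: algebra_simps power2_eq_square)
      then show ?thesis using s by simp
    qed
    also have "\<dots> \<le> (1 - s\<^sup>2) / (cmod (cis t - z))\<^sup>2"
      using le pos s by (intro divide_left_mono) (auto simp: power_le_one)
    also have "\<dots> = poisson_kernel z t" by (simp add: poisson_kernel_eq z)
    finally show ?thesis .
  qed
  have zl: "cmod z < 1" using z s by simp
  have "l * (1 / (4 * (1 - s))) = (LINT t:I|lborel. 1 / (4 * (1 - s)))"
    using I \<open>l > 0\<close> by (simp add: set_lebesgue_integral_def measure_def)
  also have "\<dots> \<le> (LINT t:I|lborel. poisson_kernel z t)"
  proof (rule set_integral_mono)
    show "set_integrable lborel I (\<lambda>t. 1 / (4 * (1 - s)))"
      using I by (simp add: set_integrable_def integrable_indicator_iff)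
    show "set_integrable lborel I (poisson_kernel z)" by (rule poisson_integrable[OF I(1,2) zl])
  qed (rule ker)
  also have "(LINT t:I|lborel. poisson_kernel z t) \<le> (LINT t:S|lborel. poisson_kernel z t)"
    using zl by (intro set_integral_mono_subset poisson_integrable S I poisson_kernel_nonneg \<open>I \<subseteq> S\<close>) auto
  finally have "l * (1 / (4 * (1 - s))) \<le> (LINT t:S|lborel. poisson_kernel z t)" .
  moreover have "l * (1 / (4 * (1 - s))) = \<alpha> / 4" unfolding l_def using s by (auto simp: divide_simps)
  ultimately have "\<alpha> / 4 \<le> (LINT t:S|lborel. poisson_kernel z t)"
    by linarith
  then have "\<alpha> / 4 / (2 * pi) \<le> (LINT t:S|lborel. poisson_kernel z t) / (2 * pi)"
    by (intro divide_right_mono) auto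
  then show ?thesis by (simp add: poisson_integral_def z_def)
qed

text \<open>An averaging argument instead of Fatou's theorem. A lower bound \<epsilon> on all radii
  over \<open>K\<close> would survive integration over \<open>K\<close>. After exchanging the
  integrals, the inner one is 2 pi times the harmonic measure of \<open>K\<close> seen from
  \<open>s n * cis t\<close>, which tends to 0 for almost every \<open>t\<close> in \<open>S\<close>
  because \<open>K\<close> is closed; it is bounded by 2 pi, so the whole integral tends to
  0.\<close>

lemma poisson_integral_small:
  assumes K: "compact K" "K \<subseteq> {0..2*pi}" "measure lborel K > 0" and "\<epsilon> > 0" "s0 < 1"
  shows "\<exists>s \<theta>. s0 < s \<and> 0 < s \<and> s < 1 \<and> \<theta> \<in> K \<and> poisson_integral ({0..2*pi} - K) (of_real s * cis \<theta>) < \<epsilon>"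
proof (rule ccontr)
  assume contr: "\<not> ?thesis"
  define S where "S = {0..2*pi} - K"
  have Kb: "K \<in> sets borel" using K(1) by (simp add: borel_compact)
  have S: "S \<in> sets borel" "S \<subseteq> {0..2*pi}" using Kb by (auto simp: S_def)
  define s where "s n = 1 - 1 / (real n + 2)" for n
  have s: "0 < s n" "s n < 1" for n by (auto simp: s_def)
  have slim: "s \<longlonglongrightarrow> 1" unfolding s_def by real_asymp
  have cb: "cball 0 (s n) \<subseteq> ball (0::complex) 1" for n using s(2)[of n] by auto
  define v where "v n t = (LINT \<theta>:K|lborel. poisson_kernel (of_real (s n) * cis \<theta>) t)" for n t
  have kc: "continuous_on T (\<lambda>\<theta>. poisson_kernel (of_real (s n) * cis \<theta>) t)" for n t T
    by (rule continuous_on_compose2[OF continuous_on_poisson_kernel])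
      (use s[of n] in \<open>auto intro!: continuous_intros simp: norm_mult\<close>)
  have ki: "set_integrable lborel K (\<lambda>\<theta>. poisson_kernel (of_real (s n) * cis \<theta>) t)"
    "set_integrable lborel {0..2*pi} (\<lambda>\<theta>. poisson_kernel (of_real (s n) * cis \<theta>) t)" for n t
    unfolding set_integrable_def by (intro borel_integrable_compact kc K(1) compact_Icc)+
  have Kc: "set_integrable lborel K (\<lambda>\<theta>. c :: real)" for c
    unfolding set_integrable_def by (intro borel_integrable_compact K(1) continuous_intros)
  have kn: "poisson_kernel (of_real (s n) * cis \<theta>) t \<ge> 0" for n t \<theta>
    using s[of n] by (intro poisson_kernel_nonneg) (simp add: norm_mult)
  have v0: "v n t \<ge> 0" for n t
    unfolding v_def set_lebesgue_integral_def by (intro Bochner_Integration.integral_nonneg) (simp add: kn)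
  \<comment> \<open>The integration is over the angle of the point, not over that of the kernel, so
    the total mass comes from harmonicity: the mean over the circle is the value 1 of the kernel at
    the origin.\<close>
  have v1: "v n t \<le> 2 * pi" for n t
  proof -
    have "v n t \<le> (LINT \<theta>:{0..2*pi}|lborel. poisson_kernel (of_real (s n) * cis \<theta>) t)"
      unfolding v_def by (intro set_integral_mono_subset ki kn K(2))
    also have "\<dots> = 2 * pi * cmean (\<lambda>z. poisson_kernel z t) 0 (s n)"
      using integral_eq_LINT_circle[of 0 "s n" "\<lambda>z. poisson_kernel z t"] s[of n]
        continuous_on_subset[OF continuous_on_poisson_kernel, of "sphere 0 (s n)" t]
      by (simp add: cmean_def subset_iff)
    also have "\<dots> = 2 * pi"
      using s[of n] by (subst cmean_poisson_kernel[OF cb]) (auto simp: poisson_kernel_def)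
    finally show ?thesis .
  qed
  have vlim: "(\<lambda>n. v n t) \<longlonglongrightarrow> 0" if t: "t \<in> S" "t \<noteq> 0" "t \<noteq> 2*pi" for t
  proof -
    have "cis t \<notin> cis ` K"
    proof
      assume "cis t \<in> cis ` K"
      then obtain \<theta> where \<theta>: "\<theta> \<in> K" "cis t = cis \<theta>" by auto
      then have "sin t = sin \<theta> \<and> cos t = cos \<theta>" by (simp add: complex_eq_iff)
      then obtain n where n: "t = \<theta> + 2 * pi * of_int n" using sin_cos_eq_iff by metis
      have "\<theta> \<in> {0..2*pi}" "t \<in> {0<..<2*pi}" using \<theta> K(2) t by (auto simp: S_def less_le)
      then have "\<bar>2 * pi * of_int n\<bar> < 2 * pi * 1" using n by auto
      then have "\<bar>of_int n :: real\<bar> < 1" by (simp add: abs_mult)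
      then have "n = 0" by linarith
      then show False using n \<theta> t by (auto simp: S_def)
    qed
    moreover have "compact (cis ` K)"
      by (intro compact_continuous_image K(1) continuous_intros)
    ultimately obtain d where d: "d > 0" "\<And>y. y \<in> cis ` K \<Longrightarrow> d \<le> dist (cis t) y"
      using separate_point_closed compact_imp_closed by metis
    have "\<forall>\<^sub>F n in sequentially. s n > 1 - d/2"
      using d(1) by (intro order_tendstoD[OF slim]) simp
    then have ev: "\<forall>\<^sub>F n in sequentially. v n t \<le> (1 - (s n)\<^sup>2) * (4 / d\<^sup>2) * measure lborel K"
    proof eventually_elim
      case (elim n)
      have "poisson_kernel (of_real (s n) * cis \<theta>) t \<le> (1 - (s n)\<^sup>2) * (4 / d\<^sup>2)" if "\<theta> \<in> K" for \<theta>
      proof -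
        have "cis \<theta> - of_real (s n) * cis \<theta> = of_real (1 - s n) * cis \<theta>" by (simp add: algebra_simps)
        then have "cmod (cis \<theta> - of_real (s n) * cis \<theta>) = 1 - s n"
          using s[of n] by (simp add: norm_mult del: of_real_diff)
        moreover have "d \<le> cmod (cis t - cis \<theta>)" using d(2) that by (auto simp: dist_norm)
        moreover have "cmod (cis t - cis \<theta>) \<le> cmod (cis t - of_real (s n) * cis \<theta>) + cmod (cis \<theta> - of_real (s n) * cis \<theta>)"
          using norm_triangle_ineq4[of "cis t - of_real (s n) * cis \<theta>" "cis \<theta> - of_real (s n) * cis \<theta>"] by simp
        ultimately have ge: "d/2 \<le> cmod (cis t - of_real (s n) * cis \<theta>)" using elim by linarith
        then have "cmod (cis t - of_real (s n) * cis \<theta>) > 0" using d(1) by linarith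
        then have "(1 - (s n)\<^sup>2) / (cmod (cis t - of_real (s n) * cis \<theta>))\<^sup>2 \<le> (1 - (s n)\<^sup>2) / (d/2)\<^sup>2"
          using ge d(1) s[of n] by (intro divide_left_mono power_mono) (auto simp: power_le_one)
        then show ?thesis using s[of n] by (simp add: poisson_kernel_eq norm_mult power_divide)
      qed
      then have "v n t \<le> (LINT \<theta>:K|lborel. (1 - (s n)\<^sup>2) * (4 / d\<^sup>2))"
        unfolding v_def by (intro set_integral_mono ki Kc)
      also have "\<dots> = (1 - (s n)\<^sup>2) * (4 / d\<^sup>2) * measure lborel K"
        using Kb by (simp add: set_lebesgue_integral_def)
      finally show ?case .
    qed
    have "(\<lambda>n. (1 - (s n)\<^sup>2) * (4 / d\<^sup>2) * measure lborel K) \<longlonglongrightarrow> (1 - 1\<^sup>2) * (4 / d\<^sup>2) * measure lborel K"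
      by (intro tendsto_intros slim)
    then show ?thesis
      by (intro tendsto_sandwich[OF _ ev tendsto_const]) (auto simp: v0)
  qed
  have "(\<lambda>n. LINT t|lborel. indicat_real S t *\<^sub>R v n t) \<longlonglongrightarrow> integral\<^sup>L lborel (\<lambda>t::real. 0::real)"
  proof (rule integral_dominated_convergence[where w = "\<lambda>t. indicat_real S t *\<^sub>R (2 * pi)"])
    have "integrable lborel (indicat_real S)"
      using S(1) emeasure_angles_finite[OF S(2)] by (simp add: integrable_indicator_iff)
    then show "integrable lborel (\<lambda>t. indicat_real S t *\<^sub>R (2 * pi))" by auto
    have [measurable]: "(\<lambda>\<theta>. of_real (s n) * cis \<theta>) \<in> borel_measurable borel" for n
      by (intro borel_measurable_continuous_onI continuous_intros)
    note S(1)[measurable] Kb[measurable]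
    show "(\<lambda>t. indicat_real S t *\<^sub>R v n t) \<in> borel_measurable lborel" for n
      unfolding v_def set_lebesgue_integral_def by measurable
    show "AE t in lborel. norm (indicat_real S t *\<^sub>R v n t) \<le> indicat_real S t *\<^sub>R (2 * pi)" for n
      using v0 v1 by (auto simp: indicator_def)
    have "AE t in lborel. t \<noteq> (0::real)" "AE t in lborel. t \<noteq> 2 * pi"
      by (rule AE_lborel_singleton)+
    then show "AE t in lborel. (\<lambda>n. indicat_real S t *\<^sub>R v n t) \<longlonglongrightarrow> 0"
    proof eventually_elim
      case (elim t)
      then show ?case using vlim[of t] by (cases "t \<in> S") auto
    qed
  qed auto
  then have lim0: "(\<lambda>n. LINT t:S|lborel. v n t) \<longlonglongrightarrow> 0" by (simp add: set_lebesgue_integral_def)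
  have "\<forall>\<^sub>F n in sequentially. s n > s0" using \<open>s0 < 1\<close> by (rule order_tendstoD[OF slim])
  then have "\<forall>\<^sub>F n in sequentially. 2 * pi * \<epsilon> * measure lborel K \<le> (LINT t:S|lborel. v n t)"
  proof eventually_elim
    case (elim n)
    have "2 * pi * \<epsilon> * measure lborel K = (LINT \<theta>:K|lborel. 2 * pi * \<epsilon>)"
      using Kb by (simp add: set_lebesgue_integral_def)
    also have "\<dots> \<le> (LINT \<theta>:K|lborel. 2 * pi * poisson_integral S (of_real (s n) * cis \<theta>))"
    proof (rule set_integral_mono)
      show "set_integrable lborel K (\<lambda>\<theta>. 2 * pi * \<epsilon>)"
        by (rule Kc)
      have "continuous_on K (\<lambda>\<theta>. poisson_integral S (of_real (s n) * cis \<theta>))"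
        by (rule continuous_on_compose2[OF continuous_on_poisson_integral[OF S]])
          (use s[of n] in \<open>auto intro!: continuous_intros simp: norm_mult\<close>)
      then show "set_integrable lborel K (\<lambda>\<theta>. 2 * pi * poisson_integral S (of_real (s n) * cis \<theta>))"
        unfolding set_integrable_def by (intro borel_integrable_compact K(1) continuous_intros)
      show "2 * pi * \<epsilon> \<le> 2 * pi * poisson_integral S (of_real (s n) * cis \<theta>)" if "\<theta> \<in> K" for \<theta>
      proof -
        have "\<not> poisson_integral S (of_real (s n) * cis \<theta>) < \<epsilon>"
          using contr that elim s[of n] unfolding S_def by blast
        then show ?thesis by simp
      qed
    qed
    also have "\<dots> = (LINT \<theta>:K|lborel. LINT t:S|lborel. poisson_kernel (0 + of_real (s n) * cis \<theta>) t)"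
      by (simp add: poisson_integral_def)
    also have "\<dots> = (LINT t:S|lborel. v n t)"
      unfolding v_def by (subst poisson_fubini[OF S Kb K(2) cb s(1)]) simp
    finally show ?case .
  qed
  then have "2 * pi * \<epsilon> * measure lborel K \<le> 0"
    by (rule tendsto_lowerbound[OF lim0]) simp
  moreover have "2 * pi * \<epsilon> * measure lborel K > 0"
    using K(3) \<open>\<epsilon> > 0\<close> by (intro mult_pos_pos) auto
  ultimately show False by linarith
qed


section \<open>Sawtooth regions\<close>

text \<open>Teeth with tips over \<open>K\<close>. The cut at radius \<open>s0\<close> discards the
  part where the boundary behaviour gives no control, at the price of an inner circle in the
  frontier.\<close>

definition sawtooth :: "real set \<Rightarrow> real \<Rightarrow> real \<Rightarrow> complex set" where
  "sawtooth K \<alpha> s0 = {z \<in> ball 0 1. s0 < cmod z \<and> (\<exists>\<theta>\<in>K. z \<in> approach_region \<alpha> (cis \<theta>))}"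

lemma sawtooth_subset: "sawtooth K \<alpha> s0 \<subseteq> ball 0 1"
  by (auto simp: sawtooth_def)

lemma open_approach_region: "open (approach_region \<alpha> \<omega>)"
proof -
  have "open {z. cmod (z - \<omega> * of_real (cmod z)) < \<alpha> * (1 - cmod z)}"
    by (intro open_Collect_less continuous_intros)
  then have "open (ball 0 1 \<inter> {z. cmod (z - \<omega> * of_real (cmod z)) < \<alpha> * (1 - cmod z)})" by auto
  moreover have "approach_region \<alpha> \<omega> = ball 0 1 \<inter> {z. cmod (z - \<omega> * of_real (cmod z)) < \<alpha> * (1 - cmod z)}"
    by (auto simp: approach_region_def)
  ultimately show ?thesis by simp
qed

lemma open_sawtooth: "open (sawtooth K \<alpha> s0)"
proof -
  have "open {z. s0 < cmod z}" by (intro open_Collect_less continuous_intros)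
  then have "open (ball 0 1 \<inter> {z. s0 < cmod z} \<inter> (\<Union>\<theta>\<in>K. approach_region \<alpha> (cis \<theta>)))"
    using open_approach_region by auto
  also have "ball 0 1 \<inter> {z. s0 < cmod z} \<inter> (\<Union>\<theta>\<in>K. approach_region \<alpha> (cis \<theta>)) = sawtooth K \<alpha> s0"
    by (auto simp: sawtooth_def)
  finally show ?thesis .
qed

lemma isCont_imp_nhd_less:
  fixes w :: "complex \<Rightarrow> real"
  assumes "isCont w y" "c < w y"
  shows "\<exists>T. open T \<and> y \<in> T \<and> (\<forall>x\<in>T. c < w x)"
proof -
  have "\<forall>\<^sub>F x in nhds y. c < w x"
    using assms unfolding isCont_def tendsto_at_iff_tendsto_nhds by (rule order_tendstoD)
  then show ?thesis unfolding eventually_nhds by blast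
qed

text \<open>
  The comparison function is \<open>M + N (P / c + Q - 1)\<close>, where \<open>P\<close> is the harmonic measure of the
  complement of \<open>K\<close>, which is at least \<open>c\<close> on the teeth, and \<open>Q\<close> is a superharmonic function
  taking care of the inner circle. It bounds \<open>h\<close> for every \<open>N\<close>, and the bracket is
  negative somewhere.
\<close>
lemma submean_sawtooth_minus_infty:
  assumes K: "compact K" "K \<subseteq> {0..2*pi}" "measure lborel K > 0"
    and \<alpha>: "0 < \<alpha>" "\<alpha> < 1" and s0: "0 \<le> s0" "s0 < 1"
    and h: "locally_submean (sawtooth K \<alpha> s0) h"
    and M: "\<And>z. z \<in> sawtooth K \<alpha> s0 \<Longrightarrow> h z \<le> ereal M"
    and lim: "\<And>N::real. \<exists>s<1. \<forall>z\<in>sawtooth K \<alpha> s0. s < cmod z \<longrightarrow> h z \<le> ereal N"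
  shows "\<exists>T. open T \<and> T \<noteq> {} \<and> T \<subseteq> sawtooth K \<alpha> s0 \<and> (\<forall>z\<in>T. h z = -\<infinity>)"
proof -
  define D where "D = sawtooth K \<alpha> s0"
  have "open D" "D \<subseteq> ball 0 1" "bounded D"
    unfolding D_def
    by (rule open_sawtooth sawtooth_subset bounded_subset[OF bounded_ball sawtooth_subset])+
  define S where "S = {0..2*pi} - K"
  have S: "S \<in> sets borel" "S \<subseteq> {0..2*pi}" using K(1) by (auto simp: S_def borel_compact)
  define c where "c = \<alpha> / (8 * pi)"
  have "c > 0" using \<alpha> by (simp add: c_def)
  \<comment> \<open>Normalises Q = (1 - |z|^2) / q to be 1 on the inner circle |z| = s0, while it
    vanishes on the unit circle and so is small near the tips.\<close>
  define q where "q = 1 - s0\<^sup>2"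
  have "q > 0" using s0 by (simp add: q_def power_less_one_iff abs_square_less_1)
  define l where "l z = poisson_integral S z / c + (1 - (cmod z)\<^sup>2) / q - 1" for z
  have contl: "continuous_on (ball 0 1) l"
    unfolding l_def using \<open>c > 0\<close> \<open>q > 0\<close>
    by (intro continuous_intros continuous_on_poisson_integral S) auto
  have P0: "poisson_integral S z / c \<ge> 0" if "z \<in> ball 0 1" for z
    using that \<open>c > 0\<close> by (intro divide_nonneg_pos poisson_integral_nonneg) auto
  have Q0: "(1 - (cmod z)\<^sup>2) / q \<ge> 0" if "z \<in> ball 0 1" for z
    using that \<open>q > 0\<close> by (intro divide_nonneg_pos) (auto simp: power_le_one)
  have meanl: "cmean l a r \<le> l a" if "cball a r \<subseteq> ball 0 1" "r > 0" for a r
  proof -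
    have sph: "sphere a r \<subseteq> ball 0 1" using that by (auto simp: subset_iff)
    have c1: "continuous_on (sphere a r) (poisson_integral S)"
      by (rule continuous_on_subset[OF continuous_on_poisson_integral[OF S] sph])
    have "cmean l a r = cmean (\<lambda>z. (1 / c) * poisson_integral S z + ((- 1 / q) * (cmod z)\<^sup>2 + (1 / q - 1))) a r"
      by (simp add: l_def[abs_def] diff_divide_distrib algebra_simps)
    also have "\<dots> = cmean (\<lambda>z. (1 / c) * poisson_integral S z) a r
        + (cmean (\<lambda>z. (- 1 / q) * (cmod z)\<^sup>2) a r + cmean (\<lambda>z. 1 / q - 1) a r)"
    proof -
      have "cmean (\<lambda>z. (- 1 / q) * (cmod z)\<^sup>2 + (1 / q - 1)) a r
          = cmean (\<lambda>z. (- 1 / q) * (cmod z)\<^sup>2) a r + cmean (\<lambda>z. 1 / q - 1) a r"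
        using \<open>r > 0\<close> by (intro cmean_add continuous_intros) auto
      moreover have "cmean (\<lambda>z. (1 / c) * poisson_integral S z + ((- 1 / q) * (cmod z)\<^sup>2 + (1 / q - 1))) a r
          = cmean (\<lambda>z. (1 / c) * poisson_integral S z) a r + cmean (\<lambda>z. (- 1 / q) * (cmod z)\<^sup>2 + (1 / q - 1)) a r"
        using \<open>r > 0\<close> by (intro cmean_add continuous_intros c1) auto
      ultimately show ?thesis by (simp only:)
    qed
    also have "\<dots> = (1 / c) * poisson_integral S a + ((- 1 / q) * ((cmod a)\<^sup>2 + r\<^sup>2) + (1 / q - 1))"
      unfolding cmean_cmult cmean_const cmean_norm_square[OF \<open>r > 0\<close>] cmean_poisson_integral[OF S that] ..
    also have "\<dots> = l a - r\<^sup>2 / q"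
      by (simp add: l_def diff_divide_distrib add_divide_distrib algebra_simps)
    also have "\<dots> \<le> l a" using \<open>q > 0\<close> by simp
    finally show ?thesis .
  qed
  have l_boundary: "l z \<ge> 0" if z: "z \<in> closure D" "z \<notin> D" "cmod z < 1" for z
  proof -
    have "closure D \<subseteq> {z. s0 \<le> cmod z}"
      by (intro closure_minimal closed_Collect_le continuous_intros) (auto simp: D_def sawtooth_def)
    then have "s0 \<le> cmod z" using z by auto
    then consider "cmod z = s0" | "s0 < cmod z" by fastforce
    then show ?thesis
    proof cases
      case 1
      then have "(1 - (cmod z)\<^sup>2) / q = 1" using \<open>q > 0\<close> by (simp add: q_def)
      then show ?thesis using P0[of z] z by (simp add: l_def)
    next
      case 2
      define \<phi> where "\<phi> = Arg2pi z"
      have zphi: "z = of_real (cmod z) * cis \<phi>" "\<phi> \<in> {0..2*pi}"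
        using Arg2pi_eq[of z] Arg2pi[of z] by (auto simp: \<phi>_def cis_conv_exp less_imp_le)
      have "poisson_integral S (of_real (cmod z) * cis \<phi>) \<ge> \<alpha> / (8 * pi)"
      proof (rule poisson_integral_ge[OF S _ z(3) zphi(2) \<alpha>])
        \<comment> \<open>Since \<open>z\<close> lies in no tooth, no angle of \<open>K\<close>
          gives a direction within \<alpha> (1 - |z|) of that of \<open>z\<close>: for such a
          \<open>t\<close> the defining distance of the approach region is |z| |cis t - cis \<phi>|,
          which is smaller still.\<close>
        fix t assume t: "t \<in> {0..2*pi}" "cmod (cis t - cis \<phi>) < \<alpha> * (1 - cmod z)"
        have "t \<notin> K"
        proof
          assume "t \<in> K"
          have "z - cis t * of_real (cmod z) = of_real (cmod z) * (cis \<phi> - cis t)"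
            by (subst zphi(1)) (simp add: algebra_simps)
          then have "cmod (z - cis t * of_real (cmod z)) = cmod z * cmod (cis t - cis \<phi>)"
            by (simp add: norm_mult norm_minus_commute)
          also have "\<dots> \<le> 1 * cmod (cis t - cis \<phi>)"
            using z(3) by (intro mult_right_mono) auto
          finally have "z \<in> approach_region \<alpha> (cis t)"
            using t z by (simp add: approach_region_def)
          then have "z \<in> D" using \<open>t \<in> K\<close> 2 z by (auto simp: D_def sawtooth_def)
          then show False using z by simp
        qed
        then show "t \<in> S" using t by (simp add: S_def)
      qed auto
      then have "poisson_integral S z \<ge> c"
        unfolding c_def by (subst zphi(1))
      then have "poisson_integral S z / c \<ge> 1" using \<open>c > 0\<close> by simp
      then show ?thesis using Q0[of z] z by (simp add: l_def)
    qed
  qed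
  have bound: "h z \<le> ereal (M + N * l z)" if "N > 0" "z \<in> D" for N z
  proof (rule max_principle[where D = D and h = h and z = z and w = "\<lambda>z. M + N * l z"])
    show "open D" "bounded D" "z \<in> D" by fact+
    show "locally_submean D h" using h by (simp add: D_def)
    show "locally_supermean D (\<lambda>z. M + N * l z)"
      unfolding locally_supermean_def
    proof (intro conjI ballI)
      show "continuous_on D (\<lambda>z. M + N * l z)"
        by (intro continuous_intros continuous_on_subset[OF contl] \<open>D \<subseteq> ball 0 1\<close>)
      fix a assume "a \<in> D"
      then have "cmod a < 1" using \<open>D \<subseteq> ball 0 1\<close> by auto
      have "cmean (\<lambda>z. M + N * l z) a r \<le> M + N * l a" if r: "0 < r" "r < 1 - cmod a" for r
      proof -
        have sub: "cball a r \<subseteq> ball 0 1"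
        proof
          fix x assume "x \<in> cball a r"
          then show "x \<in> ball 0 1"
            using norm_triangle_ineq[of a "x - a"] r by (simp add: dist_norm norm_minus_commute)
        qed
        have "continuous_on (sphere a r) l"
          by (rule continuous_on_subset[OF contl]) (use sub in auto)
        then have "cmean (\<lambda>z. M + N * l z) a r = M + N * cmean l a r"
          using r by (subst cmean_add) (auto intro!: continuous_intros simp: cmean_cmult)
        then show ?thesis using meanl[OF sub r(1)] \<open>N > 0\<close> by simp
      qed
      then show "\<exists>r0>0. \<forall>r. 0 < r \<and> r < r0 \<longrightarrow> cmean (\<lambda>z. M + N * l z) a r \<le> M + N * l a"
        using \<open>cmod a < 1\<close> by (intro exI[of _ "1 - cmod a"]) auto
    qed
  next
    fix z and \<epsilon> :: real assume z: "z \<in> frontier D" and "\<epsilon> > 0"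
    have zD: "z \<in> closure D" "z \<notin> D"
      using z interior_open[OF \<open>open D\<close>] unfolding frontier_def by auto
    have "closure D \<subseteq> cball 0 1"
      using \<open>D \<subseteq> ball 0 1\<close> by (intro closure_minimal) auto
    then have "cmod z \<le> 1" using zD by auto
    then consider "cmod z = 1" | "cmod z < 1" by fastforce
    then show "\<exists>T. open T \<and> z \<in> T \<and> (\<forall>x\<in>T \<inter> D. h x \<le> ereal (M + N * l x + \<epsilon>))"
    proof cases
      case 1
      \<comment> \<open>The bracket \<open>l\<close> is at least -1 on the disc, so the comparison
        function is at least M - N; this level is the one to ask of the uniform limit.\<close>
      obtain s where s: "s < 1" "\<And>x. x \<in> D \<Longrightarrow> s < cmod x \<Longrightarrow> h x \<le> ereal (M - N)"
        using lim[of "M - N"] by (auto simp: D_def)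
      have "h x \<le> ereal (M + N * l x + \<epsilon>)" if x: "x \<in> D" "s < cmod x" for x
      proof -
        have "x \<in> ball 0 1" using x \<open>D \<subseteq> ball 0 1\<close> by auto
        then have "l x \<ge> -1" using P0[of x] Q0[of x] by (simp add: l_def)
        then have "N * l x \<ge> N * (-1)" using \<open>N > 0\<close> by (intro mult_left_mono) auto
        then have "ereal (M - N) \<le> ereal (M + N * l x + \<epsilon>)" using \<open>\<epsilon> > 0\<close> by simp
        then show ?thesis using s(2)[OF x] order_trans by blast
      qed
      moreover have "open {x::complex. s < cmod x}" by (intro open_Collect_less continuous_intros)
      ultimately show ?thesis using 1 s(1) by (intro exI[of _ "{x. s < cmod x}"]) auto
    next
      case 2
      then have "l z \<ge> 0" using l_boundary zD by blast
      then have "N * l z > - \<epsilon>" using \<open>N > 0\<close> \<open>\<epsilon> > 0\<close> mult_nonneg_nonneg[of N "l z"] by linarith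
      moreover have "isCont (\<lambda>x. N * l x) z"
        using contl 2 by (intro continuous_intros) (simp add: continuous_on_eq_continuous_at)
      ultimately obtain T where T: "open T" "z \<in> T" "\<forall>x\<in>T. - \<epsilon> < N * l x"
        using isCont_imp_nhd_less by blast
      have "h x \<le> ereal (M + N * l x + \<epsilon>)" if "x \<in> T \<inter> D" for x
      proof -
        have "h x \<le> ereal M" using M that by (auto simp: D_def)
        also have "ereal M \<le> ereal (M + N * l x + \<epsilon>)" using that T(3) by auto
        finally show ?thesis .
      qed
      then show ?thesis using T by blast
    qed
  qed
  have "open (D \<inter> l -` {..<0})"
    by (intro continuous_open_preimage continuous_on_subset[OF contl] \<open>open D\<close> \<open>D \<subseteq> ball 0 1\<close>) auto
  moreover have "D \<inter> l -` {..<0} \<noteq> {}"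
  proof -
    \<comment> \<open>A point on the axis of a tooth with both terms of the bracket below 1/2: the
      harmonic measure is below c / 2, and 1 - s < q / 4 gives 1 - s^2 < q / 2.\<close>
    obtain s \<theta> where s: "max s0 (1 - q / 4) < s" "0 < s" "s < 1" "\<theta> \<in> K"
      "poisson_integral S (of_real s * cis \<theta>) < c / 2"
      using poisson_integral_small[OF K, of "c / 2" "max s0 (1 - q / 4)"] \<open>c > 0\<close> \<open>q > 0\<close> s0
      unfolding S_def by auto
    define z where "z = of_real s * cis \<theta>"
    have z: "cmod z = s" using s by (simp add: z_def norm_mult)
    have "z \<in> approach_region \<alpha> (cis \<theta>)"
      using s z \<alpha> by (auto simp: approach_region_def z_def norm_mult mult.commute)
    then have "z \<in> D" using s z by (auto simp: D_def sawtooth_def)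
    moreover have "1 - s\<^sup>2 < q / 2"
    proof -
      have "1 - s\<^sup>2 = (1 - s) * (1 + s)" by (simp add: power2_eq_square algebra_simps)
      also have "\<dots> \<le> (1 - s) * 2" using s by (intro mult_left_mono) auto
      also have "\<dots> < q / 2" using s by simp
      finally show ?thesis .
    qed
    then have "(1 - (cmod z)\<^sup>2) / q < 1 / 2" using \<open>q > 0\<close> z by (simp add: divide_less_eq)
    moreover have "poisson_integral S z / c < 1 / 2" using s \<open>c > 0\<close> by (simp add: z_def divide_less_eq)
    ultimately have "z \<in> D" "l z < 0" unfolding l_def by linarith+
    then show ?thesis by auto
  qed
  moreover have "h z = -\<infinity>" if "z \<in> D" "l z < 0" for z
    using bound that by (intro ereal_eq_minus_infty[of "l z" _ M]) auto
  ultimately show ?thesis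
    by (intro exI[of _ "D \<inter> l -` {..<0}"]) (auto simp: D_def)
qed

text \<open>Read \<open>F N m\<close> as the angles where level \<open>N\<close> is reached from
  stage \<open>m\<close> on. By continuity from above, a suitable stage \<open>m N\<close> loses
  little measure for each level, and intersecting over all levels gives uniform stages on a set that
  is still closed.\<close>

lemma egorov_closed:
  fixes F :: "nat \<Rightarrow> nat \<Rightarrow> real set"
  assumes F: "\<And>N m. closed (F N m)" "\<And>N m. F N m \<subseteq> {a..b}" "\<And>N. incseq (F N)"
    and pos: "measure lborel (\<Inter>N. \<Union>m. F N m) > 0"
  shows "\<exists>m. measure lborel (\<Inter>N. F N (m N)) > 0"
proof -
  define T where "T = (\<Inter>N. \<Union>m. F N m)"
  have Fb [measurable]: "F N m \<in> sets lborel" for N m using F(1) by simp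
  have Tb [measurable]: "T \<in> sets lborel" unfolding T_def by measurable
  define \<mu> where "\<mu> = measure lborel T"
  have "\<mu> > 0" using pos by (simp add: \<mu>_def T_def)
  have "T \<subseteq> {a..b}" unfolding T_def using F(2) by blast
  have fin: "emeasure lborel B < \<infinity>" if "B \<subseteq> T" for B
  proof -
    have "emeasure lborel B \<le> emeasure lborel {a..b}"
      using that \<open>T \<subseteq> {a..b}\<close> by (intro emeasure_mono) auto
    also have "\<dots> < \<infinity>" by (simp add: emeasure_lborel_Icc_eq)
    finally show ?thesis .
  qed
  \<comment> \<open>The exponent N + 2 makes the losses add up to \<mu> / 2, so that half of the
    measure survives.\<close>
  have "\<exists>m. measure lborel (T - F N m) < \<mu> * (1/2) ^ (N + 2)" for N
  proof -
    have "(\<lambda>m. measure lborel (T - F N m)) \<longlonglongrightarrow> measure lborel (\<Inter>m. T - F N m)"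
      using F(3)[of N] fin[of "T - F N _"] Tb Fb
      by (intro Lim_measure_decseq) (auto simp: decseq_def incseq_def less_top[symmetric])
    also have "(\<Inter>m. T - F N m) = {}" by (auto simp: T_def)
    finally have "\<forall>\<^sub>F m in sequentially. measure lborel (T - F N m) < \<mu> * (1/2) ^ (N + 2)"
      using \<open>\<mu> > 0\<close> by (intro order_tendstoD) auto
    then show ?thesis by (auto simp: eventually_sequentially)
  qed
  then obtain m where m: "\<And>N. measure lborel (T - F N (m N)) < \<mu> * (1/2) ^ (N + 2)" by metis
  define K where "K = (\<Inter>N. F N (m N))"
  have "K \<subseteq> T" by (auto simp: K_def T_def)
  have Kb [measurable]: "K \<in> sets lborel" unfolding K_def by measurable
  have "measure lborel (T - K) \<le> (\<Sum>N. \<mu> * (1/2) ^ (N + 2))"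
  proof -
    have sm: "summable (\<lambda>N. \<mu> * (1/2::real) ^ (N + 2))"
      by (intro summable_mult summable_ignore_initial_segment summable_geometric) auto
    have "T - K = (\<Union>N. T - F N (m N))" by (auto simp: K_def)
    then have "emeasure lborel (T - K) \<le> (\<Sum>N. emeasure lborel (T - F N (m N)))"
      using Tb Fb by (simp only:) (intro emeasure_subadditive_countably, auto)
    also have "\<dots> \<le> (\<Sum>N. ennreal (\<mu> * (1/2) ^ (N + 2)))"
    proof (intro suminf_le allI)
      fix N
      have "emeasure lborel (T - F N (m N)) = ennreal (measure lborel (T - F N (m N)))"
        using fin[of "T - F N (m N)"] by (intro emeasure_eq_ennreal_measure) auto
      then show "emeasure lborel (T - F N (m N)) \<le> ennreal (\<mu> * (1/2) ^ (N + 2))"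
        using m[of N] by (simp add: ennreal_leI)
    qed auto
    also have "\<dots> = ennreal (\<Sum>N. \<mu> * (1/2) ^ (N + 2))"
      using \<open>\<mu> > 0\<close> sm by (intro suminf_ennreal2) auto
    finally show ?thesis
      using \<open>\<mu> > 0\<close> sm by (simp add: measure_def enn2real_leI suminf_nonneg)
  qed
  also have "(\<Sum>N. \<mu> * (1/2) ^ (N + 2)) = \<mu> / 2"
  proof -
    have "(\<lambda>N. \<mu> / 4 * (1/2) ^ N) sums (\<mu> / 4 * (1 / (1 - 1/2)))"
      by (intro sums_mult geometric_sums) simp
    then have "(\<lambda>N. \<mu> * (1/2) ^ (N + 2)) sums (\<mu> / 2)"
      by (simp add: power2_eq_square)
    then show ?thesis by (rule sums_unique[symmetric])
  qed
  finally have "measure lborel (T - K) \<le> \<mu> / 2" .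
  moreover have "measure lborel (T - K) = \<mu> - measure lborel K"
    unfolding \<mu>_def using fin[of T] \<open>K \<subseteq> T\<close> Tb Kb
    by (intro measure_Diff) (auto simp: fmeasurable_def)
  ultimately have "measure lborel K > 0" using \<open>\<mu> > 0\<close> by simp
  then show ?thesis unfolding K_def by blast
qed


section \<open>Affine reparametrization of holomorphic discs\<close>

lemma frechet_derivative_affine:
  assumes "f differentiable (at (m *\<^sub>R x + c))"
  shows "(\<lambda>x. f (m *\<^sub>R x + c)) differentiable (at x)"
    and "frechet_derivative (\<lambda>x. f (m *\<^sub>R x + c)) (at x) =
      (\<lambda>v. frechet_derivative f (at (m *\<^sub>R x + c)) (m *\<^sub>R v))"
proof -
  have "((\<lambda>x. m *\<^sub>R x + c) has_derivative (\<lambda>v. m *\<^sub>R v)) (at x)"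
    by (auto intro!: derivative_eq_intros)
  moreover have "(f has_derivative frechet_derivative f (at (m *\<^sub>R x + c))) (at (m *\<^sub>R x + c))"
    using assms by (simp add: frechet_derivative_works)
  ultimately have *: "((\<lambda>x. f (m *\<^sub>R x + c)) has_derivative
      (\<lambda>v. frechet_derivative f (at (m *\<^sub>R x + c)) (m *\<^sub>R v))) (at x)"
    using diff_chain_at by (fastforce simp: o_def)
  then show "(\<lambda>x. f (m *\<^sub>R x + c)) differentiable (at x)"
    by (rule differentiableI)
  show "frechet_derivative (\<lambda>x. f (m *\<^sub>R x + c)) (at x) =
      (\<lambda>v. frechet_derivative f (at (m *\<^sub>R x + c)) (m *\<^sub>R v))"
    using frechet_derivative_at[OF *] by simp
qed

text \<open>The derivative of the composite in direction \<open>v\<close> is the affine composite of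
  the derivative of \<open>f\<close> in direction \<open>m v\<close>, so the induction has to range
  over \<open>f\<close>.\<close>

lemma Ck_on_affine: "Ck_on k UNIV f \<Longrightarrow> Ck_on k UNIV (\<lambda>x. f (m *\<^sub>R x + c))"
proof (induction k arbitrary: f)
  case 0
  then have "continuous_on UNIV f" by simp
  then have "continuous_on UNIV (\<lambda>x. f (m *\<^sub>R x + c))"
    by (rule continuous_on_compose2) (auto intro!: continuous_intros)
  then show ?case by simp
next
  case (Suc k)
  then have diff: "\<And>x. f differentiable (at x)"
    and ck: "\<And>v. Ck_on k UNIV (\<lambda>x. frechet_derivative f (at x) v)" by auto
  show ?case
    using Suc.IH[OF ck] by (simp add: frechet_derivative_affine[OF diff])
qed

section \<open>Affine change of variables for integrals and weak derivatives\<close>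

lemma mem_cbox_affine:
  fixes x :: "'d::euclidean_space"
  assumes "m > 0"
  shows "x \<in> cbox ((a - c) /\<^sub>R m) ((b - c) /\<^sub>R m) \<longleftrightarrow> m *\<^sub>R x + c \<in> cbox a b"
  using assms by (simp add: mem_box inner_simps field_simps)

lemma bounded_affine_image:
  fixes K :: "'d::euclidean_space set"
  assumes "bounded K"
  shows "\<exists>a b. (\<lambda>x. m *\<^sub>R x + c) ` K \<subseteq> cbox a b"
proof -
  have "bounded ((+) c ` (\<lambda>x. m *\<^sub>R x) ` K)" by (intro bounded_translation bounded_scaling assms)
  then have "bounded ((\<lambda>x. m *\<^sub>R x + c) ` K)" by (simp add: image_image add.commute)
  then show ?thesis by (meson bounded_subset_cbox_symmetric)
qed

text \<open>Substitution is carried out on a box around the image, after extending \<open>f\<close>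
  by zero.\<close>

lemma integrable_on_affine_image:
  fixes f :: "'d::euclidean_space \<Rightarrow> 'e::euclidean_space"
  assumes "m > 0" "bounded K" and f: "f integrable_on (\<lambda>x. m *\<^sub>R x + c) ` K"
  shows "(\<lambda>x. f (m *\<^sub>R x + c)) integrable_on K"
proof -
  let ?\<phi> = "\<lambda>x. m *\<^sub>R x + c"
  obtain a b where ab: "?\<phi> ` K \<subseteq> cbox a b" using bounded_affine_image[OF assms(2)] by blast
  then have "(\<lambda>x. if x \<in> ?\<phi> ` K then f x else 0) integrable_on cbox a b"
    using f by (simp add: integrable_on_def)
  then have "(\<lambda>x. if ?\<phi> x \<in> ?\<phi> ` K then f (?\<phi> x) else 0) integrable_on
      cbox ((a - c) /\<^sub>R m) ((b - c) /\<^sub>R m)"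
    using has_integral_affinity'[OF _ \<open>m > 0\<close>] unfolding integrable_on_def by blast
  moreover have "?\<phi> x \<in> ?\<phi> ` K \<longleftrightarrow> x \<in> K" for x using \<open>m > 0\<close> by auto
  moreover have "K \<subseteq> cbox ((a - c) /\<^sub>R m) ((b - c) /\<^sub>R m)"
    using ab mem_cbox_affine[OF \<open>m > 0\<close>] by blast
  ultimately show ?thesis by (simp add: integrable_on_def)
qed

text \<open>The domains need not correspond under the map, as for a test function with compact
  support: both integrals reduce to boxes around the set \<open>K\<close> that carries the
  integrand.\<close>

lemma integral_affine_image:
  fixes F :: "'d::euclidean_space \<Rightarrow> 'e::euclidean_space"
  assumes "m > 0" "bounded K" and F: "\<And>x. x \<notin> K \<Longrightarrow> F (m *\<^sub>R x + c) = 0"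
    and K: "K \<subseteq> \<Omega>'" "(\<lambda>x. m *\<^sub>R x + c) ` K \<subseteq> \<Omega>"
  shows "integral \<Omega>' (\<lambda>x. F (m *\<^sub>R x + c)) = integral \<Omega> F /\<^sub>R m ^ DIM('d)"
proof -
  let ?\<phi> = "\<lambda>x. m *\<^sub>R x + c"
  obtain a b where ab: "?\<phi> ` K \<subseteq> cbox a b" using bounded_affine_image[OF assms(2)] by blast
  have F': "F y = 0" if "y \<notin> ?\<phi> ` K" for y
  proof -
    have y: "?\<phi> ((y - c) /\<^sub>R m) = y" using \<open>m > 0\<close> by simp
    have "(y - c) /\<^sub>R m \<notin> K"
    proof
      assume "(y - c) /\<^sub>R m \<in> K"
      then have "?\<phi> ((y - c) /\<^sub>R m) \<in> ?\<phi> ` K" by (rule imageI)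
      then show False using that unfolding y by simp
    qed
    from F[OF this] show ?thesis unfolding y .
  qed
  have 1: "integral \<Omega> F = integral (cbox a b) F"
  proof -
    have "(\<lambda>x. if x \<in> \<Omega> then F x else 0) = (\<lambda>x. if x \<in> cbox a b then F x else 0)"
    proof
      fix x
      have "x \<in> ?\<phi> ` K \<Longrightarrow> x \<in> \<Omega> \<and> x \<in> cbox a b" using ab K by blast
      then show "(if x \<in> \<Omega> then F x else 0) = (if x \<in> cbox a b then F x else 0)"
        using F'[of x] by (cases "x \<in> ?\<phi> ` K") simp_all
    qed
    from arg_cong[OF this, of "integral UNIV"] show ?thesis by (simp only: integral_restrict_UNIV)
  qed
  have sub: "K \<subseteq> cbox ((a - c) /\<^sub>R m) ((b - c) /\<^sub>R m)"
    using ab mem_cbox_affine[OF \<open>m > 0\<close>] by blast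
  have 2: "integral \<Omega>' (\<lambda>x. F (?\<phi> x)) = integral (cbox ((a - c) /\<^sub>R m) ((b - c) /\<^sub>R m)) (\<lambda>x. F (?\<phi> x))"
  proof -
    have "(\<lambda>x. if x \<in> \<Omega>' then F (?\<phi> x) else 0) =
        (\<lambda>x. if x \<in> cbox ((a - c) /\<^sub>R m) ((b - c) /\<^sub>R m) then F (?\<phi> x) else 0)"
    proof
      fix x
      have "x \<in> K \<Longrightarrow> x \<in> \<Omega>' \<and> x \<in> cbox ((a - c) /\<^sub>R m) ((b - c) /\<^sub>R m)"
        using sub K by blast
      then show "(if x \<in> \<Omega>' then F (?\<phi> x) else 0) =
          (if x \<in> cbox ((a - c) /\<^sub>R m) ((b - c) /\<^sub>R m) then F (?\<phi> x) else 0)"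
        using F[of x] by (cases "x \<in> K") simp_all
    qed
    from arg_cong[OF this, of "integral UNIV"] show ?thesis by (simp only: integral_restrict_UNIV)
  qed
  have iff: "((\<lambda>x. F (?\<phi> x)) has_integral (I /\<^sub>R m ^ DIM('d))) (cbox ((a - c) /\<^sub>R m) ((b - c) /\<^sub>R m))
      \<longleftrightarrow> (F has_integral I) (cbox a b)" for I
    by (rule has_integral_affinity_iff[OF \<open>m > 0\<close>])
  show ?thesis
  proof (cases "F integrable_on cbox a b")
    case True
    then have "(F has_integral integral (cbox a b) F) (cbox a b)" by (rule integrable_integral)
    then show ?thesis unfolding 1 2 by (intro integral_unique iff[THEN iffD2])
  next
    case False
    \<comment> \<open>The two integrability statements are equivalent; if both fail, both integrals
      have the default value 0.\<close>
    have "\<not> (\<lambda>x. F (?\<phi> x)) integrable_on cbox ((a - c) /\<^sub>R m) ((b - c) /\<^sub>R m)"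
    proof
      assume "(\<lambda>x. F (?\<phi> x)) integrable_on cbox ((a - c) /\<^sub>R m) ((b - c) /\<^sub>R m)"
      then obtain I where I: "((\<lambda>x. F (?\<phi> x)) has_integral I) (cbox ((a - c) /\<^sub>R m) ((b - c) /\<^sub>R m))"
        unfolding integrable_on_def by blast
      moreover have "I = (m ^ DIM('d) *\<^sub>R I) /\<^sub>R m ^ DIM('d)" using \<open>m > 0\<close> by simp
      ultimately have "(F has_integral (m ^ DIM('d) *\<^sub>R I)) (cbox a b)"
        by (intro iff[THEN iffD1]) (simp only:)
      then show False using False has_integral_integrable by blast
    qed
    then show ?thesis unfolding 1 2 using False by (simp add: not_integrable_integral)
  qed
qed

text \<open>A test function on \<Omega>' is transported to \<Omega> by the inverse map. Its
  derivative picks up the factor 1 / m, which the factor \<open>m\<close> in the new weak derivative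
  cancels.\<close>

lemma has_weak_derivative_on_affine:
  fixes f g :: "'d::euclidean_space \<Rightarrow> 'e::euclidean_space"
  assumes f: "has_weak_derivative_on f e g \<Omega>" and "m > 0"
    and sub: "(\<lambda>x. m *\<^sub>R x + c) ` \<Omega>' \<subseteq> \<Omega>"
  shows "has_weak_derivative_on (\<lambda>x. f (m *\<^sub>R x + c)) e (\<lambda>x. m *\<^sub>R g (m *\<^sub>R x + c)) \<Omega>'"
  unfolding has_weak_derivative_on_def
proof (intro conjI allI impI)
  let ?\<phi> = "\<lambda>x::'d. m *\<^sub>R x + c"
  have cont: "continuous_on K ?\<phi>" for K by (intro continuous_intros)
  have loc: "locally_integrable_on (\<lambda>x. h (?\<phi> x)) \<Omega>'" if h: "locally_integrable_on h \<Omega>"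
    for h :: "'d \<Rightarrow> 'e"
    unfolding locally_integrable_on_def
  proof (intro allI impI)
    fix K assume K: "compact K \<and> K \<subseteq> \<Omega>'"
    then have "compact (?\<phi> ` K)" "?\<phi> ` K \<subseteq> \<Omega>"
      using cont compact_continuous_image sub by blast+
    then have "h absolutely_integrable_on ?\<phi> ` K" using h by (simp add: locally_integrable_on_def)
    then show "(\<lambda>x. h (?\<phi> x)) absolutely_integrable_on K"
      using K compact_imp_bounded \<open>m > 0\<close> unfolding absolutely_integrable_on_def
      by (auto intro!: integrable_on_affine_image[of m K h] integrable_on_affine_image[of m K "\<lambda>x. norm (h x)"])
  qed
  show "locally_integrable_on (\<lambda>x. f (?\<phi> x)) \<Omega>'"
    using f by (intro loc) (simp add: has_weak_derivative_on_def)
  have "locally_integrable_on (\<lambda>x. g (?\<phi> x)) \<Omega>'"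
    using f by (intro loc) (simp add: has_weak_derivative_on_def)
  then show "locally_integrable_on (\<lambda>x. m *\<^sub>R g (?\<phi> x)) \<Omega>'"
    unfolding locally_integrable_on_def by (auto intro: absolutely_integrable_scaleR_left)
  fix \<psi> assume "test_function \<Omega>' \<psi>"
  then obtain K where smooth: "smooth_on UNIV \<psi>" and K: "compact K" "K \<subseteq> \<Omega>'" "\<And>x. x \<notin> K \<Longrightarrow> \<psi> x = 0"
    unfolding test_function_def by blast
  have diff: "\<psi> differentiable (at x)" for x
  proof -
    have "Ck_on (Suc 0) UNIV \<psi>" using smooth unfolding smooth_on_def by blast
    then show ?thesis by simp
  qed
  have zero: "frechet_derivative \<psi> (at x) e = 0" if "x \<notin> K" for x
  proof -
    have "open (- K)" using K(1) compact_imp_closed by auto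
    moreover have "((\<lambda>x. 0) has_derivative (\<lambda>v. 0)) (at x)" by simp
    ultimately have "(\<psi> has_derivative (\<lambda>v. 0)) (at x)"
      using has_derivative_transform_within_open[of "\<lambda>x. 0" "\<lambda>v. 0" x UNIV "- K" \<psi>] that K(3) by auto
    then show ?thesis using frechet_derivative_at by metis
  qed
  define \<psi>' where "\<psi>' y = \<psi> ((1 / m) *\<^sub>R y + (- (1 / m) *\<^sub>R c))" for y
  have inv: "(1 / m) *\<^sub>R ?\<phi> x + (- (1 / m) *\<^sub>R c) = x" for x
    using \<open>m > 0\<close> by (simp add: algebra_simps)
  have inv': "?\<phi> ((1 / m) *\<^sub>R y + (- (1 / m) *\<^sub>R c)) = y" for y
    using \<open>m > 0\<close> by (simp add: algebra_simps)
  have "test_function \<Omega> \<psi>'"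
    unfolding test_function_def
  proof (intro conjI exI)
    show "smooth_on UNIV \<psi>'"
      using smooth unfolding smooth_on_def \<psi>'_def by (blast intro: Ck_on_affine)
    show "compact (?\<phi> ` K)" using cont compact_continuous_image K(1) by blast
    show "?\<phi> ` K \<subseteq> \<Omega>" using K(2) sub by auto
    show "\<forall>y. y \<notin> ?\<phi> ` K \<longrightarrow> \<psi>' y = 0"
    proof (intro allI impI)
      fix y assume "y \<notin> ?\<phi> ` K"
      then have "(1 / m) *\<^sub>R y + (- (1 / m) *\<^sub>R c) \<notin> K"
        using inv'[of y] by (metis (no_types, lifting) image_eqI)
      then show "\<psi>' y = 0" unfolding \<psi>'_def by (rule K(3))
    qed
  qed
  then have eq: "integral \<Omega> (\<lambda>y. frechet_derivative \<psi>' (at y) e *\<^sub>R f y) = - integral \<Omega> (\<lambda>y. \<psi>' y *\<^sub>R g y)"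
    using f by (simp add: has_weak_derivative_on_def)
  have fd: "frechet_derivative \<psi>' (at (?\<phi> x)) e = frechet_derivative \<psi> (at x) e / m" for x
  proof -
    have "frechet_derivative \<psi>' (at (?\<phi> x)) e = frechet_derivative \<psi> (at x) ((1 / m) *\<^sub>R e)"
      unfolding \<psi>'_def using frechet_derivative_affine(2)[of \<psi> "1 / m" "?\<phi> x" "- (1 / m) *\<^sub>R c"] diff inv
      by simp
    also have "linear (frechet_derivative \<psi> (at x))"
      using diff by (rule linear_frechet_derivative)
    then have "frechet_derivative \<psi> (at x) ((1 / m) *\<^sub>R e) = frechet_derivative \<psi> (at x) e / m"
      by (simp add: linear_cmul)
    finally show ?thesis .
  qed
  have bK: "bounded K" using K(1) by (rule compact_imp_bounded)
  have sK: "?\<phi> ` K \<subseteq> \<Omega>" using K(2) sub by auto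
  have "integral \<Omega>' (\<lambda>x. frechet_derivative \<psi>' (at (?\<phi> x)) e *\<^sub>R f (?\<phi> x)) =
      integral \<Omega> (\<lambda>y. frechet_derivative \<psi>' (at y) e *\<^sub>R f y) /\<^sub>R m ^ DIM('d)"
    by (rule integral_affine_image[OF \<open>m > 0\<close> bK _ K(2) sK]) (simp add: fd zero)
  also have "\<dots> = - (integral \<Omega> (\<lambda>y. \<psi>' y *\<^sub>R g y) /\<^sub>R m ^ DIM('d))"
    by (simp add: eq)
  also have "integral \<Omega> (\<lambda>y. \<psi>' y *\<^sub>R g y) /\<^sub>R m ^ DIM('d) =
      integral \<Omega>' (\<lambda>x. \<psi>' (?\<phi> x) *\<^sub>R g (?\<phi> x))"
    by (rule integral_affine_image[OF \<open>m > 0\<close> bK _ K(2) sK, symmetric]) (simp add: \<psi>'_def inv K(3) del: scaleR_minus_left)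
  also have "(\<lambda>x. \<psi>' (?\<phi> x) *\<^sub>R g (?\<phi> x)) = (\<lambda>x. \<psi> x *\<^sub>R g (?\<phi> x))"
    unfolding \<psi>'_def inv ..
  finally have *: "integral \<Omega>' (\<lambda>x. (1 / m) *\<^sub>R (frechet_derivative \<psi> (at x) e *\<^sub>R f (?\<phi> x))) =
      - integral \<Omega>' (\<lambda>x. \<psi> x *\<^sub>R g (?\<phi> x))"
    by (simp add: fd)
  have "integral \<Omega>' (\<lambda>x. frechet_derivative \<psi> (at x) e *\<^sub>R f (?\<phi> x)) =
      m *\<^sub>R integral \<Omega>' (\<lambda>x. (1 / m) *\<^sub>R (frechet_derivative \<psi> (at x) e *\<^sub>R f (?\<phi> x)))"
    using \<open>m > 0\<close> by (simp only: integral_cmul) simp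
  also have "\<dots> = - (m *\<^sub>R integral \<Omega>' (\<lambda>x. \<psi> x *\<^sub>R g (?\<phi> x)))"
    unfolding * by simp
  also have "m *\<^sub>R integral \<Omega>' (\<lambda>x. \<psi> x *\<^sub>R g (?\<phi> x)) = integral \<Omega>' (\<lambda>x. m *\<^sub>R (\<psi> x *\<^sub>R g (?\<phi> x)))"
    by (simp only: integral_cmul)
  also have "(\<lambda>x. m *\<^sub>R (\<psi> x *\<^sub>R g (?\<phi> x))) = (\<lambda>x. \<psi> x *\<^sub>R (m *\<^sub>R g (?\<phi> x)))"
    by (simp add: mult.commute)
  finally show "integral \<Omega>' (\<lambda>x. frechet_derivative \<psi> (at x) e *\<^sub>R f (?\<phi> x)) =
      - integral \<Omega>' (\<lambda>x. \<psi> x *\<^sub>R (m *\<^sub>R g (?\<phi> x)))" .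
qed

lemma AE_lebesgue_affine:
  fixes P :: "'d::euclidean_space \<Rightarrow> bool"
  assumes P: "AE x in lebesgue. P x" and "m > 0"
  shows "AE x in lebesgue. P (m *\<^sub>R x + c)"
proof -
  obtain N where N: "negligible N" "{x. \<not> P x} \<subseteq> N"
    using P unfolding eventually_ae_filter_negligible by blast
  have "negligible ((\<lambda>x. (1 / m) *\<^sub>R (- c + x)) ` N)"
    by (intro negligible_differentiable_image_negligible N)
      (auto simp: differentiable_on_def intro!: derivative_intros)
  moreover have "{x. \<not> P (m *\<^sub>R x + c)} \<subseteq> (\<lambda>x. (1 / m) *\<^sub>R (- c + x)) ` N"
  proof
    fix x assume "x \<in> {x. \<not> P (m *\<^sub>R x + c)}"
    then have "m *\<^sub>R x + c \<in> N" using N(2) by auto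
    moreover have "x = (1 / m) *\<^sub>R (- c + (m *\<^sub>R x + c))" using \<open>m > 0\<close> by simp
    ultimately show "x \<in> (\<lambda>x. (1 / m) *\<^sub>R (- c + x)) ` N" by blast
  qed
  ultimately show ?thesis unfolding eventually_ae_filter_negligible by blast
qed

text \<open>A real dilation with a translation preserves the directions of x and y. Both weak
  partial derivatives are thus multiplied by the same \<open>R\<close>, and the linear equation
  survives.\<close>

lemma J_holomorphic_rescale:
  assumes u: "J_holomorphic X A J u" and "R > 0" and sub: "ball a R \<subseteq> \<Delta>"
  shows "J_holomorphic X A J (\<lambda>z. u (R *\<^sub>R z + a))"
  unfolding J_holomorphic_def
proof (intro conjI ballI)
  have into: "R *\<^sub>R z + a \<in> \<Delta>" if "z \<in> \<Delta>" for z
  proof -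
    have "R *\<^sub>R z + a \<in> ball a R" using that \<open>R > 0\<close> by (simp add: dist_norm)
    then show ?thesis using sub by blast
  qed
  show "(\<lambda>z. u (R *\<^sub>R z + a)) ` \<Delta> \<subseteq> X"
    using u into unfolding J_holomorphic_def by blast
  show "continuous_on \<Delta> (\<lambda>z. u (R *\<^sub>R z + a))"
    by (rule continuous_on_compose2[of \<Delta> u])
      (use u into in \<open>auto simp: J_holomorphic_def intro!: continuous_intros simp del: mem_ball_0\<close>)
  fix c assume "c \<in> A"
  define \<Omega> where "\<Omega> = {z \<in> \<Delta>. u z \<in> fst c}"
  define \<Omega>' where "\<Omega>' = {z \<in> \<Delta>. u (R *\<^sub>R z + a) \<in> fst c}"
  obtain fx fy where f: "has_weak_derivative_on (snd c \<circ> u) 1 fx \<Omega>"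
    "has_weak_derivative_on (snd c \<circ> u) \<i> fy \<Omega>"
    "AE z in lebesgue. z \<in> \<Omega> \<longrightarrow> fx z + blinfun_apply (J c (u z)) (fy z) = 0"
    using u \<open>c \<in> A\<close> unfolding J_holomorphic_def Let_def \<Omega>_def by blast
  have im: "(\<lambda>z. R *\<^sub>R z + a) ` \<Omega>' \<subseteq> \<Omega>"
    using into by (auto simp: \<Omega>_def \<Omega>'_def simp del: mem_ball_0)
  have AE: "AE z in lebesgue. z \<in> \<Omega>' \<longrightarrow>
      R *\<^sub>R fx (R *\<^sub>R z + a) + blinfun_apply (J c (u (R *\<^sub>R z + a))) (R *\<^sub>R fy (R *\<^sub>R z + a)) = 0"
    using AE_lebesgue_affine[OF f(3) \<open>R > 0\<close>, of a]
  proof eventually_elim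
    case (elim z)
    show ?case
    proof
      assume "z \<in> \<Omega>'"
      then have "fx (R *\<^sub>R z + a) + blinfun_apply (J c (u (R *\<^sub>R z + a))) (fy (R *\<^sub>R z + a)) = 0"
        using elim im by blast
      then show "R *\<^sub>R fx (R *\<^sub>R z + a) + blinfun_apply (J c (u (R *\<^sub>R z + a))) (R *\<^sub>R fy (R *\<^sub>R z + a)) = 0"
        by (simp add: blinfun.scaleR_right flip: scaleR_add_right)
    qed
  qed
  show "let \<Omega> = {z \<in> \<Delta>. u (R *\<^sub>R z + a) \<in> fst c} in
        \<exists>fx fy. has_weak_derivative_on (snd c \<circ> (\<lambda>z. u (R *\<^sub>R z + a))) 1 fx \<Omega> \<and>
          has_weak_derivative_on (snd c \<circ> (\<lambda>z. u (R *\<^sub>R z + a))) \<i> fy \<Omega> \<and>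
          (AE z in lebesgue. z \<in> \<Omega> \<longrightarrow> fx z + blinfun_apply (J c (u (R *\<^sub>R z + a))) (fy z) = 0)"
    unfolding Let_def \<Omega>'_def[symmetric] o_def
    using has_weak_derivative_on_affine[OF f(1) \<open>R > 0\<close> im] has_weak_derivative_on_affine[OF f(2) \<open>R > 0\<close> im] AE
    unfolding o_def by blast
qed


section \<open>Boundary values in a stratified set\<close>

text \<open>Positive and negative parts are compared separately; monotonicity of the nonnegative
  integral asks for no measurability of \<open>f\<close>. The parts of the continuous majorant have
  finite integrals, so their difference is an ordinary one.\<close>

lemma circle_mean_le:
  assumes g: "continuous_on (sphere a r) g" and "r > 0"
    and le: "\<And>z. z \<in> sphere a r \<Longrightarrow> f z \<le> ereal (g z)"
  shows "circle_mean f a r \<le> ereal (cmean g a r)"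
proof -
  define G where "G t = g (a + of_real r * cis t)" for t
  let ?M = "uniform_measure lborel {0..2*pi}"
  have contG: "continuous_on S G" for S
    unfolding G_def using g \<open>r > 0\<close> by (intro continuous_on_circle) auto
  then have Gm [measurable]: "G \<in> borel_measurable borel"
    by (intro borel_measurable_continuous_onI)
  have "set_integrable lborel {0..2*pi} G"
    by (intro borel_integrable_atLeastAtMost' contG)
  then have int: "integrable lborel (\<lambda>t. indicat_real {0..2*pi} t / (2*pi) * G t)"
    by (simp add: set_integrable_def)
  have dens: "?M = density lborel (\<lambda>t. ennreal (indicat_real {0..2*pi} t / (2*pi)))"
    unfolding uniform_measure_def
    by (intro density_cong) (auto simp: indicator_def divide_ennreal simp flip: ennreal_1)
  have intM: "integrable ?M G"
    unfolding dens by (subst integrable_real_density) (use int in auto)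
  have "integral\<^sup>L ?M G = (LINT t|lborel. indicat_real {0..2*pi} t / (2*pi) * G t)"
    unfolding dens by (subst integral_real_density) auto
  also have "\<dots> = (LINT t:{0..2*pi}|lborel. G t) / (2*pi)"
    by (simp add: set_lebesgue_integral_def)
  also have "\<dots> = cmean g a r"
    unfolding cmean_def G_def using g \<open>r > 0\<close> by (subst integral_eq_LINT_circle) auto
  finally have G: "integral\<^sup>L ?M G = cmean g a r" .
  have fin: "(\<integral>\<^sup>+t. ennreal (G t) \<partial>?M) < \<infinity>" "(\<integral>\<^sup>+t. ennreal (- G t) \<partial>?M) < \<infinity>"
    using intM by (auto simp: real_integrable_def less_top)
  have e: "enn2ereal x = ereal (enn2real x)" if "x < \<infinity>" for x
    using that by (cases x) (auto simp: enn2ereal_ennreal)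
  have fG: "f (a + of_real r * cis t) \<le> ereal (G t)" for t
    using le[OF circle_in_sphere] \<open>r > 0\<close> by (simp add: G_def)
  have "circle_mean f a r \<le> enn2ereal (\<integral>\<^sup>+t. ennreal (G t) \<partial>?M) - enn2ereal (\<integral>\<^sup>+t. ennreal (- G t) \<partial>?M)"
    unfolding circle_mean_def ext_integral_def
  proof (intro ereal_minus_mono)
    show "enn2ereal (\<integral>\<^sup>+t. e2ennreal (f (a + of_real r * cis t)) \<partial>?M) \<le> enn2ereal (\<integral>\<^sup>+t. ennreal (G t) \<partial>?M)"
      unfolding less_eq_ennreal.rep_eq[symmetric]
      using e2ennreal_mono[OF fG] by (intro nn_integral_mono) simp
    show "enn2ereal (\<integral>\<^sup>+t. ennreal (- G t) \<partial>?M) \<le> enn2ereal (\<integral>\<^sup>+t. e2ennreal (- f (a + of_real r * cis t)) \<partial>?M)"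
      unfolding less_eq_ennreal.rep_eq[symmetric]
    proof (intro nn_integral_mono)
      fix t
      have "ereal (- G t) \<le> - f (a + of_real r * cis t)"
        using fG[of t] by (metis ereal_minus_le_minus uminus_ereal.simps(1))
      then show "ennreal (- G t) \<le> e2ennreal (- f (a + of_real r * cis t))"
        using e2ennreal_mono by fastforce
    qed
  qed
  also have "\<dots> = ereal (integral\<^sup>L ?M G)"
    using intM by (simp add: e[OF fin(1)] e[OF fin(2)] real_lebesgue_integral_def)
  finally show ?thesis by (simp add: G)
qed

lemma open_holomorphic_vimage:
  assumes "J_holomorphic X A J u" "open U"
  shows "open {z \<in> \<Delta>. u z \<in> U}"
proof -
  have "open (\<Delta> \<inter> u -` U)"
    using assms by (intro continuous_open_preimage) (auto simp: J_holomorphic_def)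
  also have "\<Delta> \<inter> u -` U = {z \<in> \<Delta>. u z \<in> U}" by auto
  finally show ?thesis .
qed

text \<open>A disc of radius \<open>R\<close> that \<open>u\<close> maps into \<open>U\<close> is
  rescaled to \<Delta>, where \<rho> may be tested. The circle of radius \<open>r\<close> becomes
  that of radius r / R around 0.\<close>

lemma locally_submean_psh:
  assumes u: "J_holomorphic X A J u" and "open U" and \<rho>: "J_psh_on X A J U \<rho>"
  shows "locally_submean {z \<in> \<Delta>. u z \<in> U} (\<lambda>z. \<rho> (u z))"
  unfolding locally_submean_def
proof (intro conjI ballI)
  let ?W = "{z \<in> \<Delta>. u z \<in> U}"
  have usc: "usc_on U \<rho>" using \<rho> by (simp add: J_psh_on_def)
  show "usc_on ?W (\<lambda>z. \<rho> (u z))"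
    unfolding usc_on_def
  proof (intro ballI allI impI)
    fix x y assume x: "x \<in> ?W" "\<rho> (u x) < y"
    then obtain T where T: "open T" "u x \<in> T" "\<forall>z\<in>T \<inter> U. \<rho> z < y"
      using usc_onD[OF usc] by blast
    have "open {z \<in> \<Delta>. u z \<in> T}" by (rule open_holomorphic_vimage[OF u T(1)])
    then show "\<forall>\<^sub>F z in at x within ?W. \<rho> (u z) < y"
      unfolding eventually_at_topological using x T by (intro exI[of _ "{z \<in> \<Delta>. u z \<in> T}"]) auto
  qed
  show "\<rho> (u z) < \<infinity>" if "z \<in> ?W" for z using that \<rho> by (auto simp: J_psh_on_def)
  fix a assume a: "a \<in> ?W"
  have "open ?W" by (rule open_holomorphic_vimage[OF u \<open>open U\<close>])
  then obtain R where R: "R > 0" "ball a R \<subseteq> ?W" using a open_contains_ball by blast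
  define v where "v z = u (R *\<^sub>R z + a)" for z
  have "J_holomorphic X A J v"
    unfolding v_def using R by (intro J_holomorphic_rescale[OF u]) auto
  moreover have "v ` \<Delta> \<subseteq> U"
  proof -
    have "R *\<^sub>R z + a \<in> ball a R" if "z \<in> \<Delta>" for z
      using that \<open>R > 0\<close> by (simp add: dist_norm)
    then show ?thesis using R(2) unfolding v_def by blast
  qed
  ultimately have sub: "subharmonic_on \<Delta> (\<rho> \<circ> v)" using \<rho> by (simp add: J_psh_on_def)
  have "\<rho> (u a) \<le> ereal (cmean g a r)"
    if r: "0 < r" "r < R" and g: "continuous_on (sphere a r) g" "\<forall>z\<in>sphere a r. \<rho> (u z) \<le> ereal (g z)" for r g
  proof -
    have "0 < r / R" "r / R < 1" using r by auto
    moreover from this have "cball 0 (r / R) \<subseteq> \<Delta>" by auto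
    moreover have "(0::complex) \<in> \<Delta>" by simp
    ultimately have "(\<rho> \<circ> v) 0 \<le> circle_mean (\<rho> \<circ> v) 0 (r / R)"
      using sub unfolding subharmonic_on_def by blast
    also have "circle_mean (\<rho> \<circ> v) 0 (r / R) = circle_mean (\<lambda>z. \<rho> (u z)) a r"
      using R(1) by (simp add: circle_mean_def v_def scaleR_conv_of_real add.commute)
    also have "\<dots> \<le> ereal (cmean g a r)" using r g by (intro circle_mean_le) auto
    finally show ?thesis by (simp add: v_def)
  qed
  then show "\<exists>r0>0. \<forall>r g. 0 < r \<and> r < r0 \<and> continuous_on (sphere a r) g \<and>
      (\<forall>z\<in>sphere a r. \<rho> (u z) \<le> ereal (g z)) \<longrightarrow> \<rho> (u a) \<le> ereal (cmean g a r)"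
    using R(1) by blast
qed

section \<open>Angles whose truncated approach region lies in a given set\<close>

definition nt_angles :: "real \<Rightarrow> nat \<Rightarrow> complex set \<Rightarrow> real set" where
  "nt_angles \<alpha> m W =
     {\<theta> \<in> {0..2*pi}. \<forall>z\<in>approach_region \<alpha> (cis \<theta>). 1 - 1 / (real m + 1) < cmod z \<longrightarrow> z \<in> W}"

text \<open>Closedness for an arbitrary set \<open>W\<close> spares all discussion of measurability below.\<close>
lemma closed_nt_angles: "closed (nt_angles \<alpha> m W)"
proof -
  \<comment> \<open>Each point outside \<open>W\<close> excludes exactly the angles whose approach
    region contains it, and this is an open condition on the angle.\<close>
  have "closed ({0..2*pi} \<inter> (\<Inter>z\<in>{z\<in>\<Delta>. 1 - 1 / (real m + 1) < cmod z \<and> z \<notin> W}.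
      {\<theta>. \<alpha> * (1 - cmod z) \<le> cmod (z - cis \<theta> * of_real (cmod z))}))"
    by (intro closed_Int closed_INT ballI closed_Collect_le continuous_intros closed_atLeastAtMost)
  also have "{0..2*pi} \<inter> (\<Inter>z\<in>{z\<in>\<Delta>. 1 - 1 / (real m + 1) < cmod z \<and> z \<notin> W}.
      {\<theta>. \<alpha> * (1 - cmod z) \<le> cmod (z - cis \<theta> * of_real (cmod z))}) = nt_angles \<alpha> m W"
    unfolding nt_angles_def approach_region_def by (auto simp flip: not_less)
  finally show ?thesis .
qed

lemma incseq_nt_angles: "incseq (\<lambda>m. nt_angles \<alpha> m W)"
proof (rule incseq_SucI, rule subsetI)
  fix m \<theta> assume "\<theta> \<in> nt_angles \<alpha> m W"
  moreover have "1 - 1 / (real m + 1) \<le> 1 - 1 / (real (Suc m) + 1)" by (simp add: frac_le)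
  ultimately show "\<theta> \<in> nt_angles \<alpha> (Suc m) W"
    unfolding nt_angles_def by fastforce
qed

lemma approach_region_mono:
  assumes "\<alpha> \<le> \<beta>"
  shows "approach_region \<alpha> \<omega> \<subseteq> approach_region \<beta> \<omega>"
proof
  fix z assume "z \<in> approach_region \<alpha> \<omega>"
  moreover from this have "\<alpha> * (1 - cmod z) \<le> \<beta> * (1 - cmod z)"
    using assms by (intro mult_right_mono) (auto simp: approach_region_def)
  ultimately show "z \<in> approach_region \<beta> \<omega>"
    unfolding approach_region_def mem_Collect_eq by linarith
qed

lemma mem_nt_angles_if_eventually:
  assumes ev: "\<forall>\<^sub>F z in at (cis \<theta>) within approach_region \<alpha> (cis \<theta>). z \<in> W"
    and "\<alpha> \<le> 1" "\<theta> \<in> {0..2*pi}"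
  shows "\<exists>m. \<theta> \<in> nt_angles \<alpha> m W"
proof -
  obtain d where d: "d > 0" "\<And>z. \<lbrakk>z \<in> approach_region \<alpha> (cis \<theta>); z \<noteq> cis \<theta>; dist z (cis \<theta>) < d\<rbrakk> \<Longrightarrow> z \<in> W"
    using ev unfolding eventually_at by blast
  \<comment> \<open>In an approach region |z - cis \<theta>| is below (1 + \<alpha>) (1 - |z|),
    hence below 2 (1 - |z|), so distance \<open>d\<close> is guaranteed once 1 - |z| is less than d
    / 2.\<close>
  obtain m :: nat where m: "2 / d < real m" using reals_Archimedean2 by blast
  have "z \<in> W" if z: "z \<in> approach_region \<alpha> (cis \<theta>)" "1 - 1 / (real m + 1) < cmod z" for z
  proof (rule d(2)[OF z(1)])
    have z': "cmod z < 1" "cmod (z - cis \<theta> * of_real (cmod z)) < \<alpha> * (1 - cmod z)"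
      using z by (auto simp: approach_region_def)
    show "z \<noteq> cis \<theta>" using z' by auto
    have "cmod (cis \<theta> * of_real (cmod z) - cis \<theta>) = 1 - cmod z"
    proof -
      have "cis \<theta> * of_real (cmod z) - cis \<theta> = - (of_real (1 - cmod z) * cis \<theta>)"
        by (simp add: algebra_simps)
      then show ?thesis using z' by (simp add: norm_mult del: of_real_diff)
    qed
    moreover have "\<alpha> * (1 - cmod z) \<le> 1 * (1 - cmod z)"
      using \<open>\<alpha> \<le> 1\<close> z' by (intro mult_right_mono) auto
    moreover have "cmod (z - cis \<theta>) \<le> cmod (z - cis \<theta> * of_real (cmod z))
        + cmod (cis \<theta> * of_real (cmod z) - cis \<theta>)"
      using norm_triangle_ineq[of "z - cis \<theta> * of_real (cmod z)" "cis \<theta> * of_real (cmod z) - cis \<theta>"]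
      by simp
    ultimately have "cmod (z - cis \<theta>) < 1 * (1 - cmod z) + (1 - cmod z)"
      using z'(2) by (smt (verit))
    then have "cmod (z - cis \<theta>) < 2 * (1 - cmod z)" by simp
    also have "\<dots> < 2 * (1 / (real m + 1))" using z(2) by simp
    also have "\<dots> \<le> d" using m d(1) by (simp add: field_simps)
    finally show "dist z (cis \<theta>) < d" by (simp add: dist_norm)
  qed
  then show ?thesis using assms(3) by (auto simp: nt_angles_def)
qed

section \<open>Preimages of the strata\<close>

lemma open_strata_complement:
  assumes "open X" and V: "\<And>j. j \<le> k \<Longrightarrow> closedin (top_of_set (X - (\<Union>l<j. Vs l))) (Vs j)"
    and "j \<le> Suc k"
  shows "open (X - (\<Union>l<j. Vs l))"
  using \<open>j \<le> Suc k\<close>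
proof (induction j)
  case 0
  then show ?case using \<open>open X\<close> by simp
next
  case (Suc j)
  then have "openin (top_of_set (X - (\<Union>l<j. Vs l))) (X - (\<Union>l<j. Vs l) - Vs j)"
    using V[of j] by (simp add: openin_diff)
  then have "open (X - (\<Union>l<j. Vs l) - Vs j)"
    using Suc by (simp add: openin_open_eq)
  also have "X - (\<Union>l<j. Vs l) - Vs j = X - (\<Union>l<Suc j. Vs l)"
    by (auto simp: lessThan_Suc)
  finally show ?case .
qed

text \<open>The last clause is density of \<open>Q j\<close> in the disc. Passing from
  \<open>j\<close> to \<open>Suc j\<close> removes from \<open>Q j\<close> a set that is locally the
  pole set of a subharmonic function, so either nothing is left or connectedness and density
  persist.\<close>

lemma strata_preimage_complement:
  assumes u: "J_holomorphic X A J u" and "open X"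
    and V: "\<And>j. j \<le> k \<Longrightarrow> closedin (top_of_set (X - (\<Union>l<j. Vs l))) (Vs j)"
    and lcp: "\<And>j. j \<le> k \<Longrightarrow> locally_complete_pluripolar X A J (X - (\<Union>l<j. Vs l)) (Vs j)"
    and "j \<le> Suc k"
  defines "Q \<equiv> \<lambda>j. {z \<in> \<Delta>. u z \<in> X - (\<Union>l<j. Vs l)}"
  shows "Q j = {} \<or> connected (Q j) \<and> (\<forall>T. open T \<and> T \<subseteq> \<Delta> \<and> T \<inter> Q j = {} \<longrightarrow> T = {})"
  using \<open>j \<le> Suc k\<close>
proof (induction j)
  case 0
  have "Q 0 = \<Delta>" using u by (auto simp: Q_def J_holomorphic_def)
  then show ?case by (metis connected_ball inf.absorb_iff1)
next
  case (Suc j)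
  have opn: "open (X - (\<Union>l<i. Vs l))" if "i \<le> Suc k" for i
    by (rule open_strata_complement[OF \<open>open X\<close> V that])
  have opQ: "open (Q i)" if "i \<le> Suc k" for i
    unfolding Q_def by (rule open_holomorphic_vimage[OF u opn[OF that]])
  have QS: "Q (Suc j) \<subseteq> Q j" by (auto simp: Q_def lessThan_Suc)
  show ?case
  proof (cases "Q j = {}")
    case True
    then show ?thesis using QS by auto
  next
    case False
    then have IH: "connected (Q j)" "\<And>T. open T \<Longrightarrow> T \<subseteq> \<Delta> \<Longrightarrow> T \<inter> Q j = {} \<Longrightarrow> T = {}"
      using Suc by auto
    \<comment> \<open>The pole set is taken to be \<open>- Q (Suc j)\<close>, which is closed in the
      whole plane; inside \<open>Q j\<close> it agrees with the preimage of
      \<open>Vs j\<close>.\<close>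
    have "Q j \<subseteq> - Q (Suc j) \<or> connected (Q j - - Q (Suc j)) \<and> interior (- Q (Suc j)) \<inter> Q j = {}"
    proof (rule complement_of_poles)
      show "open (Q j)" "connected (Q j)" "closed (- Q (Suc j))"
        using opQ[of j] opQ[of "Suc j"] Suc.prems IH by auto
      fix z assume z: "z \<in> Q j"
      then have "u z \<in> X - (\<Union>l<j. Vs l)" by (simp add: Q_def)
      then obtain U \<rho> where U: "open U" "u z \<in> U" "U \<subseteq> X - (\<Union>l<j. Vs l)" "J_psh_on X A J U \<rho>"
        "Vs j \<inter> U = {x \<in> U. \<rho> x = -\<infinity>}"
      proof -
        have "locally_complete_pluripolar X A J (X - (\<Union>l<j. Vs l)) (Vs j)"
          using lcp Suc.prems by simp
        from bspec[OF this[unfolded locally_complete_pluripolar_def, THEN conjunct2] \<open>u z \<in> _\<close>]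
        show ?thesis using that by blast
      qed
      show "\<exists>N h. open N \<and> z \<in> N \<and> N \<subseteq> Q j \<and> locally_submean N h \<and>
          - Q (Suc j) \<inter> N = {x\<in>N. h x = -\<infinity>}"
      proof (intro exI conjI)
        show "open {z \<in> \<Delta>. u z \<in> U}" by (rule open_holomorphic_vimage[OF u U(1)])
        show "locally_submean {z \<in> \<Delta>. u z \<in> U} (\<lambda>z. \<rho> (u z))"
          by (rule locally_submean_psh[OF u U(1,4)])
        show "z \<in> {z \<in> \<Delta>. u z \<in> U}" using z U(2) by (simp add: Q_def)
        show "{z \<in> \<Delta>. u z \<in> U} \<subseteq> Q j" using U(3) by (auto simp: Q_def)
        have "x \<in> - Q (Suc j) \<longleftrightarrow> \<rho> (u x) = -\<infinity>" if x: "x \<in> \<Delta>" "u x \<in> U" for x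
        proof -
          have "x \<in> - Q (Suc j) \<longleftrightarrow> u x \<in> Vs j" using x U(3) by (auto simp: Q_def lessThan_Suc)
          also have "\<dots> \<longleftrightarrow> \<rho> (u x) = -\<infinity>" using x(2) U(5) by blast
          finally show ?thesis .
        qed
        then show "- Q (Suc j) \<inter> {z \<in> \<Delta>. u z \<in> U} = {x \<in> {z \<in> \<Delta>. u z \<in> U}. \<rho> (u x) = -\<infinity>}"
          by blast
      qed
    qed
    moreover have "Q j - - Q (Suc j) = Q (Suc j)" using QS by auto
    ultimately consider "Q (Suc j) = {}" | "connected (Q (Suc j))" "interior (- Q (Suc j)) \<inter> Q j = {}"
      using QS by auto
    then show ?thesis
    proof cases
      case 2
      have "T = {}" if T: "open T" "T \<subseteq> \<Delta>" "T \<inter> Q (Suc j) = {}" for T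
      proof (rule IH(2)[OF T(1,2)])
        have "T \<subseteq> interior (- Q (Suc j))" using T by (intro interior_maximal) auto
        then show "T \<inter> Q j = {}" using 2 by blast
      qed
      then show ?thesis using 2 by blast
    qed auto
  qed
qed

text \<open>The classes, indexed by a stratum, a basic open set around the limit and an aperture 1 /
  (n + 2), are countably many, and each is contained in a Borel set of angles. One of these Borel
  sets is not null, and the sawtooth over a compact part of it is used.\<close>

lemma boundary_values_imp_open_set:
  fixes k :: nat
  assumes u: "J_holomorphic X A J u"
    and lcp: "\<And>j. j \<le> k \<Longrightarrow> locally_complete_pluripolar X A J (M j) (Vs j)"
    and E: "emeasure lebesgue (angles E) > 0"
    and lim: "\<forall>\<omega>\<in>E. \<exists>p\<in>(\<Union>j\<le>k. Vs j). has_restricted_nt_limit u \<omega> p"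
  shows "\<exists>j\<le>k. \<exists>T. open T \<and> T \<noteq> {} \<and> T \<subseteq> \<Delta> \<and> u ` T \<subseteq> Vs j"
proof -
  obtain B :: "'a set set" where B: "countable B" "topological_basis B"
    using ex_countable_basis by blast
  define good where "good j b U \<rho> \<longleftrightarrow> open U \<and> b \<subseteq> U \<and> J_psh_on X A J U \<rho> \<and>
      Vs j \<inter> U = {x \<in> U. \<rho> x = -\<infinity>} \<and> (\<forall>x\<in>b. \<rho> x \<le> 0)" for j b U and \<rho> :: "'a \<Rightarrow> ereal"
  \<comment> \<open>One function serves all limit points in \<open>b\<close>: a good function is
    -\<infinity> exactly on the part of \<open>Vs j\<close> in its domain, so it is -\<infinity> at
    each of these limits, whichever of them it was found for. This keeps the index set
    countable.\<close>
  define R where "R j b = (SOME \<rho>. \<exists>U. good j b U \<rho>)" for j b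
  have R: "\<exists>U. good j b U (R j b)" if "good j b U \<rho>" for j b U \<rho>
    unfolding R_def by (rule someI_ex[where P = "\<lambda>\<rho>. \<exists>U. good j b U \<rho>"]) (use that in blast)
  define W where "W j b N = {z. u z \<in> b \<and> R j b (u z) \<le> ereal (- real N)}" for j b N
  define F where "F = (\<lambda>(j, b, n) N m. nt_angles (1 / (real n + 2)) m (W j b N))"
  define I where "I = {(j, b, n::nat). j \<le> k \<and> b \<in> B \<and> (\<exists>U \<rho>. good j b U \<rho>)}"
  have sub: "angles E \<subseteq> (\<Union>i\<in>I. \<Inter>N. \<Union>m. F i N m)"
  proof
    fix \<theta> assume \<theta>: "\<theta> \<in> angles E"
    then have "cis \<theta> \<in> E" "\<theta> \<in> {0..2*pi}" by (auto simp: angles_def)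
    then obtain p j \<alpha> where p: "j \<le> k" "p \<in> Vs j" "0 < \<alpha>"
      "(u \<longlongrightarrow> p) (at (cis \<theta>) within approach_region \<alpha> (cis \<theta>))"
      using lim unfolding has_restricted_nt_limit_def by fastforce
    have "p \<in> M j" using lcp[OF p(1)] p(2) unfolding locally_complete_pluripolar_def by blast
    then obtain U \<rho> where U: "open U" "p \<in> U" "J_psh_on X A J U \<rho>" "Vs j \<inter> U = {x \<in> U. \<rho> x = -\<infinity>}"
      using lcp[OF p(1)] unfolding locally_complete_pluripolar_def by blast
    have usc: "usc_on V \<sigma>" if "J_psh_on X A J V \<sigma>" for V \<sigma> using that by (simp add: J_psh_on_def)
    have "\<rho> p = -\<infinity>" using U p by blast
    then obtain T where T: "open T" "p \<in> T" "\<forall>z\<in>T \<inter> U. \<rho> z < 0"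
      using usc_onD[OF usc[OF U(3)] U(2), of 0] by auto
    obtain b where b: "b \<in> B" "p \<in> b" "b \<subseteq> T \<inter> U"
      using topological_basisE[OF B(2), of "T \<inter> U" p] T U by auto
    have "good j b U \<rho>" unfolding good_def using U T b by (auto intro: less_imp_le)
    then obtain U' where g: "good j b U' (R j b)" using R by blast
    obtain n where n: "1 / (real n + 2) \<le> \<alpha>"
    proof -
      obtain n :: nat where "1 / \<alpha> < real n" using reals_Archimedean2 by blast
      then have "1 / (real n + 2) \<le> \<alpha>" using p(3) by (simp add: field_simps)
      then show ?thesis using that by blast
    qed
    have lim': "(u \<longlongrightarrow> p) (at (cis \<theta>) within approach_region (1 / (real n + 2)) (cis \<theta>))"
      using p(4) approach_region_mono[OF n] by (rule tendsto_within_subset)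
    have "\<exists>m. \<theta> \<in> nt_angles (1 / (real n + 2)) m (W j b N)" for N
    proof (rule mem_nt_angles_if_eventually)
      have g': "usc_on U' (R j b)" "p \<in> U'" "R j b p = -\<infinity>"
        using g b p unfolding good_def by (auto intro: usc)
      then obtain T' where T': "open T'" "p \<in> T'" "\<forall>z\<in>T' \<inter> U'. R j b z < ereal (- real N)"
        using usc_onD[OF g'(1,2), of "ereal (- real N)"] by auto
      have "open (T' \<inter> b)" using T' b B(2) topological_basis_open by auto
      then have "\<forall>\<^sub>F z in at (cis \<theta>) within approach_region (1 / (real n + 2)) (cis \<theta>). u z \<in> T' \<inter> b"
        using T' b by (intro topological_tendstoD[OF lim']) auto
      then show "\<forall>\<^sub>F z in at (cis \<theta>) within approach_region (1 / (real n + 2)) (cis \<theta>). z \<in> W j b N"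
      proof eventually_elim
        case (elim z)
        then have "u z \<in> T' \<inter> U'" "u z \<in> b" using g unfolding good_def by auto
        then show ?case using T'(3) by (auto simp: W_def intro: less_imp_le)
      qed
      show "1 / (real n + 2) \<le> 1" by simp
      show "\<theta> \<in> {0..2*pi}" by fact
    qed
    then have "\<theta> \<in> (\<Inter>N. \<Union>m. F (j, b, n) N m)" by (auto simp: F_def)
    moreover have "(j, b, n) \<in> I" using p(1) b(1) \<open>good j b U \<rho>\<close> by (auto simp: I_def)
    ultimately show "\<theta> \<in> (\<Union>i\<in>I. \<Inter>N. \<Union>m. F i N m)" by blast
  qed
  have "countable I"
  proof (rule countable_subset)
    show "I \<subseteq> {..k} \<times> B \<times> UNIV" by (auto simp: I_def)
    show "countable ({..k} \<times> B \<times> (UNIV :: nat set))" by (intro countable_SIGMA B(1)) (auto intro: countable_finite)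
  qed
  have Fclosed: "closed (F i N m)" for i N m by (cases i) (simp add: F_def closed_nt_angles)
  have Fb: "(\<Inter>N. \<Union>m. F i N m) \<in> sets lborel" for i
  proof -
    have [measurable]: "F i N m \<in> sets lborel" for N m using Fclosed by simp
    show ?thesis by measurable
  qed
  have "\<exists>i\<in>I. (\<Inter>N. \<Union>m. F i N m) \<notin> null_sets lborel"
  proof (rule ccontr)
    assume "\<not> ?thesis"
    then have "(\<Union>i\<in>I. \<Inter>N. \<Union>m. F i N m) \<in> null_sets lborel"
      using \<open>countable I\<close> by (intro null_sets_UN') auto
    then have "angles E \<in> null_sets lebesgue"
      by (intro null_sets_completion_subset[OF sub] null_sets_completionI)
    then show False using E by (simp add: null_sets_def)
  qed
  then obtain i where i: "i \<in> I" "(\<Inter>N. \<Union>m. F i N m) \<notin> null_sets lborel" by blast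
  obtain j b n where jbn: "i = (j, b, n)" by (cases i)
  define \<alpha> where "\<alpha> = 1 / (real n + 2)"
  have \<alpha>: "0 < \<alpha>" "\<alpha> < 1" by (auto simp: \<alpha>_def)
  have F: "F i N m = nt_angles \<alpha> m (W j b N)" for N m by (simp add: F_def jbn \<alpha>_def)
  have Fsub: "F i N m \<subseteq> {0..2*pi}" for N m by (auto simp: F nt_angles_def)
  have "emeasure lborel (\<Inter>N. \<Union>m. F i N m) \<noteq> 0" using i(2) Fb by (simp add: null_sets_def)
  moreover have "emeasure lborel (\<Inter>N. \<Union>m. F i N m) < \<infinity>"
    using Fsub by (intro emeasure_angles_finite) blast
  ultimately have "measure lborel (\<Inter>N. \<Union>m. F i N m) > 0"
    by (simp add: measure_def enn2real_positive_iff zero_less_iff_neq_zero)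
  moreover have "incseq (F i N)" for N using incseq_nt_angles[of \<alpha> "W j b N"] by (simp add: F[abs_def])
  ultimately obtain m where m: "measure lborel (\<Inter>N. F i N (m N)) > 0"
    using egorov_closed[of "F i" 0 "2 * pi", OF Fclosed Fsub] by blast
  define K where "K = (\<Inter>N. F i N (m N))"
  have "K \<subseteq> {0..2*pi}" using Fsub[of 0 "m 0"] by (auto simp: K_def)
  moreover have "closed K" unfolding K_def by (intro closed_INT ballI Fclosed)
  ultimately have "compact K" using bounded_subset[OF bounded_closed_interval] by (auto simp: compact_eq_bounded_closed)
  \<comment> \<open>Over \<open>K\<close>, level -N is reached in every tooth beyond radius
    \<open>s N\<close>. Cutting at \<open>s 0\<close> ensures that \<open>u\<close> maps the whole
    region into \<open>b\<close>, where the chosen function is at most 0.\<close>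
  define s where "s N = 1 - 1 / (real (m N) + 1)" for N
  have s: "0 \<le> s N" "s N < 1" for N by (auto simp: s_def)
  have inW: "z \<in> W j b N" if "z \<in> sawtooth K \<alpha> (s 0)" "s N < cmod z" for z N
    using that unfolding sawtooth_def K_def F nt_angles_def s_def by blast
  have "\<exists>U \<rho>. good j b U \<rho>" using i(1) by (auto simp: I_def jbn)
  then obtain U where U: "good j b U (R j b)" using R by blast
  have inU: "sawtooth K \<alpha> (s 0) \<subseteq> {z \<in> \<Delta>. u z \<in> U}"
    using inW[of _ 0] U unfolding good_def W_def sawtooth_def by blast
  have "\<exists>T. open T \<and> T \<noteq> {} \<and> T \<subseteq> sawtooth K \<alpha> (s 0) \<and> (\<forall>z\<in>T. R j b (u z) = -\<infinity>)"
  proof (rule submean_sawtooth_minus_infty[OF \<open>compact K\<close> \<open>K \<subseteq> _\<close> _ \<alpha> s, where M = 0])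
    show "measure lborel K > 0" using m by (simp add: K_def)
    show "locally_submean (sawtooth K \<alpha> (s 0)) (\<lambda>z. R j b (u z))"
      using U unfolding good_def by (intro locally_submean_subset[OF locally_submean_psh[OF u] inU]) auto
    show "R j b (u z) \<le> ereal 0" if "z \<in> sawtooth K \<alpha> (s 0)" for z
      using inW[OF that, of 0] that by (auto simp: W_def sawtooth_def)
    show "\<exists>t<1. \<forall>z\<in>sawtooth K \<alpha> (s 0). t < cmod z \<longrightarrow> R j b (u z) \<le> ereal N" for N
    proof -
      obtain N' :: nat where "- N \<le> real N'" using real_arch_simple by blast
      then have "ereal (- real N') \<le> ereal N" by simp
      moreover have "R j b (u z) \<le> ereal (- real N')" if "z \<in> sawtooth K \<alpha> (s 0)" "s N' < cmod z" for z
        using inW[OF that] by (simp add: W_def)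
      ultimately show ?thesis using s(2)[of N'] order_trans by blast
    qed
  qed
  then obtain T where T: "open T" "T \<noteq> {}" "T \<subseteq> sawtooth K \<alpha> (s 0)" "\<forall>z\<in>T. R j b (u z) = -\<infinity>"
    by blast
  have "u ` T \<subseteq> Vs j" using T inU U unfolding good_def by blast
  moreover have "T \<subseteq> \<Delta>" using T(3) inU by blast
  moreover have "j \<le> k" using i(1) by (simp add: I_def jbn)
  ultimately show ?thesis using T by blast
qed

theorem theorem3p1:
  fixes X :: "'a::{t2_space, second_countable_topology} set"
    and A :: "('a, 'e::euclidean_space) chart set"
    and J :: "('a, 'e) endo_field"
    and V :: "'a set"
    and u :: "complex \<Rightarrow> 'a"
    and E :: "complex set"
  assumes "almost_complex_manifold X A J"
    and "continuous_field A J"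
    and "closedin (top_of_set X) V"
    and "has_lcp_stratification X A J V"
    and "J_holomorphic X A J u"
    and "E \<subseteq> sphere 0 1"
    and "angles E \<in> sets lebesgue"
    and "emeasure lebesgue (angles E) > 0"
    and "\<forall>\<omega>\<in>E. \<exists>p\<in>V. has_restricted_nt_limit u \<omega> p"
  shows "u ` \<Delta> \<subseteq> V"
proof -
  have "X = (\<Union>c\<in>A. fst c)" "\<And>c. c \<in> A \<Longrightarrow> open (fst c)"
    using assms(1) by (auto simp: almost_complex_manifold_def smooth_manifold_def is_chart_def split: prod.splits)
  then have "open X" by auto
  obtain k :: nat and Vs where V: "V = (\<Union>j\<le>k. Vs j)"
    "\<And>j. j \<le> k \<Longrightarrow> closedin (top_of_set (X - (\<Union>l<j. Vs l))) (Vs j)"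
    "\<And>j. j \<le> k \<Longrightarrow> locally_complete_pluripolar X A J (X - (\<Union>l<j. Vs l)) (Vs j)"
    using assms(4) unfolding has_lcp_stratification_def Let_def by blast
  obtain j T where T: "j \<le> k" "open T" "T \<noteq> {}" "T \<subseteq> \<Delta>" "u ` T \<subseteq> Vs j"
    using boundary_values_imp_open_set[OF assms(5) V(3) assms(8) assms(9)[unfolded V(1)]] by blast
  \<comment> \<open>The nonempty open set \<open>T\<close> goes into stratum \<open>j\<close> and so
    misses \<open>Q\<close>, which is therefore not dense and must be empty.\<close>
  define Q where "Q = {z \<in> \<Delta>. u z \<in> X - (\<Union>l<Suc j. Vs l)}"
  have "T \<inter> Q = {}" using T(5) by (auto simp: Q_def)
  then have "Q = {}"
    using strata_preimage_complement[OF assms(5) \<open>open X\<close> V(2,3), of k "Suc j"] T unfolding Q_def by auto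
  moreover have "u ` \<Delta> \<subseteq> X" using assms(5) by (simp add: J_holomorphic_def)
  ultimately have "u ` \<Delta> \<subseteq> (\<Union>l<Suc j. Vs l)" by (auto simp: Q_def)
  also have "\<dots> \<subseteq> V" using T(1) unfolding V(1) by (intro UN_mono) auto
  finally show ?thesis .
qed

end
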